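(* Let $A\in\widehat{\mathbb Q}^{m\times n}$. Then $\|A\|_2=\sigma_1(A)$, where $\|A\|_2=\max\{\|A\mathbf x\|_2:\mathbf x\in\widehat{\mathbb Q}^n,\ \|\mathbf x\|_2=1\}$ is the spectral norm of $A$ (maximum with respect to the total order on dual numbers) and $\sigma_1(A)$ is the largest singular value of $A$.
   Context: Dual numbers: $\widehat{\mathbb R}=\{q_{\sf st}+q_{\sf in}\epsilon: q_{\sf st},q_{\sf in}\in\mathbb R\}$ with $\epsilon\neq 0$, $\epsilon^2=0$, is a commutative ring, totally ordered by: $q<p$ iff $q_{\sf st}<p_{\sf st}$, or $q_{\sf st}=p_{\sf st}$ and $q_{\sf in}<p_{\sf in}$. For a positive appreciable dual number $q$ (i.e. $q_{\sf st}>0$), $\sqrt q=\sqrt{q_{\sf st}}+\frac{q_{\sf in}}{2\sqrt{q_{\sf st}}}\epsilon$; also $\sqrt 0=0$. Dual quaternions: let $\mathbb Q$ be the real quaternions. $\widehat{\mathbb Q}=\{q_{\sf st}+q_{\sf in}\epsilon: q_{\sf st},q_{\sf in}\in\mathbb Q\}$, where $\epsilon$ commutes with quaternions and $\epsilon^2=0$. The conjugate is $\bar q=\bar q_{\sf st}+\bar q_{\sf in}\epsilon$. The magnitude of $q$ is the dual number $|q|=|q_{\sf st}|+\frac{q_{\sf st}\bar q_{\sf in}+q_{\sf in}\bar q_{\sf st}}{2|q_{\sf st}|}\epsilon$ if $q_{\sf st}\ne0$, and $|q|=|q_{\sf in}|\epsilon$ otherwise. A scalar, vector or matrix is appreciable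 if its standard part is nonzero, infinitesimal otherwise. Vectors and matrices: for $\mathbf x=\mathbf x_{\sf st}+\mathbf x_{\sf in}\epsilon\in\widehat{\mathbb Q}^n$, $\|\mathbf x\|_2=\sqrt{\sum_i|x_i|^2}$ if $\mathbf x_{\sf st}\ne\mathbf 0$, and $\|\mathbf x\|_2=\|\mathbf x_{\sf in}\|_2\,\epsilon$ otherwise (usual Euclidean norm of a quaternion vector); this is a dual number. For $A=(a_{ij})$, $A^*=(\bar a_{ji})$; a square matrix $U$ is unitary if $U^*U=UU^*=I$. Singular values: it is known that for every $A\in\widehat{\mathbb Q}^{m\times n}$ there are unitary $U\in\widehat{\mathbb Q}^{m\times m}$, $V\in\widehat{\mathbb Q}^{n\times n}$ such that $A=U\Sigma V^*$, where $\Sigma$ is the $m\times n$ diagonal matrix with diagonal entries $\sigma_1(A)\ge\cdots\ge\sigma_s(A)\ge0$ in $\widehat{\mathbb R}$, $s=\min\{m,n\}$ (first positive appreciable ones, then positive infinitesimal ones, then possibly zeros), and these entries are uniquely determined by $A$ (with multiplicity). They are the singular values of $A$. *)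

theory Defs
  imports "HOL-Analysis.Inner_Product" "Jordan_Normal_Form.Matrix"
begin

section \<open>Real quaternions\<close>

datatype quat = Quat (qre: real) (qi: real) (qj: real) (qk: real)

lemma quat_eq_iff:
  "x = y \<longleftrightarrow> qre x = qre y \<and> qi x = qi y \<and> qj x = qj y \<and> qk x = qk y"
  by (cases x; cases y) auto

instantiation quat :: ring_1
begin

definition zero_quat :: quat where "0 = Quat 0 0 0 0"
definition one_quat :: quat where "1 = Quat 1 0 0 0"
definition plus_quat :: "quat \<Rightarrow> quat \<Rightarrow> quat" where
  "x + y = Quat (qre x + qre y) (qi x + qi y) (qj x + qj y) (qk x + qk y)"
definition uminus_quat :: "quat \<Rightarrow> quat" where
  "- x = Quat (- qre x) (- qi x) (- qj x) (- qk x)"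
definition minus_quat :: "quat \<Rightarrow> quat \<Rightarrow> quat" where
  "x - y = Quat (qre x - qre y) (qi x - qi y) (qj x - qj y) (qk x - qk y)"
definition times_quat :: "quat \<Rightarrow> quat \<Rightarrow> quat" where
  "x * y = Quat
     (qre x * qre y - qi x * qi y - qj x * qj y - qk x * qk y)
     (qre x * qi y + qi x * qre y + qj x * qk y - qk x * qj y)
     (qre x * qj y - qi x * qk y + qj x * qre y + qk x * qi y)
     (qre x * qk y + qi x * qj y - qj x * qi y + qk x * qre y)"

lemma quat_sel_simps [simp]:
  "qre 0 = 0" "qi 0 = 0" "qj 0 = 0" "qk 0 = 0"
  "qre 1 = 1" "qi 1 = 0" "qj 1 = 0" "qk 1 = 0"
  "qre (x + y) = qre x + qre y" "qi (x + y) = qi x + qi y"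
  "qj (x + y) = qj x + qj y" "qk (x + y) = qk x + qk y"
  "qre (- x) = - qre x" "qi (- x) = - qi x" "qj (- x) = - qj x" "qk (- x) = - qk x"
  "qre (x - y) = qre x - qre y" "qi (x - y) = qi x - qi y"
  "qj (x - y) = qj x - qj y" "qk (x - y) = qk x - qk y"
  by (simp_all add: zero_quat_def one_quat_def plus_quat_def uminus_quat_def minus_quat_def)

lemma quat_times_sel:
  "qre (x * y) = qre x * qre y - qi x * qi y - qj x * qj y - qk x * qk y"
  "qi (x * y) = qre x * qi y + qi x * qre y + qj x * qk y - qk x * qj y"
  "qj (x * y) = qre x * qj y - qi x * qk y + qj x * qre y + qk x * qi y"
  "qk (x * y) = qre x * qk y + qi x * qj y - qj x * qi y + qk x * qre y"
  by (simp_all add: times_quat_def)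

instance
proof
  fix x y z :: quat
  show "x * y * z = x * (y * z)"
    unfolding quat_eq_iff quat_times_sel by (simp add: algebra_simps)
  show "(x + y) * z = x * z + y * z" "x * (y + z) = x * y + x * z"
    unfolding quat_eq_iff quat_times_sel quat_sel_simps by (simp_all add: algebra_simps)
qed (simp_all add: quat_eq_iff quat_times_sel)

end

instantiation quat :: real_inner
begin

definition scaleR_quat :: "real \<Rightarrow> quat \<Rightarrow> quat" where
  "r *\<^sub>R x = Quat (r * qre x) (r * qi x) (r * qj x) (r * qk x)"
definition inner_quat :: "quat \<Rightarrow> quat \<Rightarrow> real" where
  "inner x y = qre x * qre y + qi x * qi y + qj x * qj y + qk x * qk y"
definition norm_quat :: "quat \<Rightarrow> real" where
  "norm (x :: quat) = sqrt ((qre x)\<^sup>2 + (qi x)\<^sup>2 + (qj x)\<^sup>2 + (qk x)\<^sup>2)"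
definition sgn_quat :: "quat \<Rightarrow> quat" where
  "sgn (x :: quat) = inverse (norm x) *\<^sub>R x"
definition dist_quat :: "quat \<Rightarrow> quat \<Rightarrow> real" where
  "dist (x :: quat) y = norm (x - y)"
definition uniformity_quat :: "(quat \<times> quat) filter" where
  "uniformity = (INF e\<in>{0 <..}. principal {(x :: quat, y). dist x y < e})"
definition open_quat :: "quat set \<Rightarrow> bool" where
  "open (U :: quat set) \<longleftrightarrow> (\<forall>x\<in>U. eventually (\<lambda>(x', y). x' = x \<longrightarrow> y \<in> U) uniformity)"

instance
proof
  fix x y z :: quat and r s :: real and U :: "quat set"
  show "dist x y = norm (x - y)" by (rule dist_quat_def)
  show "sgn x = inverse (norm x) *\<^sub>R x" by (rule sgn_quat_def)
  show "uniformity = (INF e\<in>{0 <..}. principal {(x :: quat, y). dist x y < e})"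
    by (rule uniformity_quat_def)
  show "open U \<longleftrightarrow> (\<forall>x\<in>U. \<forall>\<^sub>F (x', y) in uniformity. x' = x \<longrightarrow> y \<in> U)"
    by (rule open_quat_def)
  show "r *\<^sub>R (x + y) = r *\<^sub>R x + r *\<^sub>R y"
    by (simp add: quat_eq_iff scaleR_quat_def algebra_simps)
  show "(r + s) *\<^sub>R x = r *\<^sub>R x + s *\<^sub>R x"
    by (simp add: quat_eq_iff scaleR_quat_def algebra_simps)
  show "r *\<^sub>R s *\<^sub>R x = (r * s) *\<^sub>R x"
    by (simp add: quat_eq_iff scaleR_quat_def)
  show "1 *\<^sub>R x = x"
    by (simp add: quat_eq_iff scaleR_quat_def)
  show "inner x y = inner y x"
    by (simp add: inner_quat_def algebra_simps)
  show "inner (x + y) z = inner x z + inner y z"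
    by (simp add: inner_quat_def algebra_simps)
  show "inner (r *\<^sub>R x) y = r * inner x y"
    by (simp add: inner_quat_def scaleR_quat_def algebra_simps)
  show "0 \<le> inner x x"
    by (simp add: inner_quat_def)
  show "inner x x = 0 \<longleftrightarrow> x = 0"
  proof
    assume "inner x x = 0"
    then have "(qre x)\<^sup>2 + (qi x)\<^sup>2 + (qj x)\<^sup>2 + (qk x)\<^sup>2 = 0"
      by (simp add: inner_quat_def power2_eq_square)
    then show "x = 0"
      by (simp add: quat_eq_iff add_nonneg_eq_0_iff)
  qed (simp add: inner_quat_def)
  show "norm x = sqrt (inner x x)"
    by (simp add: norm_quat_def inner_quat_def power2_eq_square)
qed

end

lemma norm_quat_mult: "norm (x * y) = norm x * norm (y :: quat)"
proof -
  have "(qre (x * y))\<^sup>2 + (qi (x * y))\<^sup>2 + (qj (x * y))\<^sup>2 + (qk (x * y))\<^sup>2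
    = ((qre x)\<^sup>2 + (qi x)\<^sup>2 + (qj x)\<^sup>2 + (qk x)\<^sup>2)
      * ((qre y)\<^sup>2 + (qi y)\<^sup>2 + (qj y)\<^sup>2 + (qk y)\<^sup>2)"
    unfolding quat_times_sel by (simp add: power2_eq_square algebra_simps)
  then show ?thesis
    by (simp only: norm_quat_def real_sqrt_mult)
qed

instance quat :: real_normed_algebra_1
proof
  fix x y :: quat and r :: real
  show "r *\<^sub>R x * y = r *\<^sub>R (x * y)" "x * r *\<^sub>R y = r *\<^sub>R (x * y)"
    by (simp_all add: quat_eq_iff scaleR_quat_def quat_times_sel algebra_simps)
  show "norm (x * y) \<le> norm x * norm y"
    by (simp add: norm_quat_mult)
  show "norm (1 :: quat) = 1"
    by (simp add: norm_quat_def)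
qed

instantiation quat :: conjugate
begin

definition conjugate_quat :: "quat \<Rightarrow> quat" where
  "conjugate x = Quat (qre x) (- qi x) (- qj x) (- qk x)"

instance
  by standard (auto simp: quat_eq_iff conjugate_quat_def)

end


section \<open>Dual numbers over a ring\<close>

text \<open>\<open>Dual a b\<close> stands for $a + b\epsilon$ with $\epsilon^2 = 0$ and $\epsilon$ central.
  Dual numbers are \<^typ>\<open>real\<close>-based, dual quaternions are \<^typ>\<open>quat\<close>-based.\<close>

datatype 'a dual = Dual (st: 'a) (infp: 'a)

type_synonym dual_real = "real dual"
type_synonym dual_quat = "quat dual"

lemma dual_eq_iff: "x = y \<longleftrightarrow> st x = st y \<and> infp x = infp y"
  by (cases x; cases y) auto

instantiation dual :: (zero) zero
begin
definition zero_dual :: "'a dual" where "0 = Dual 0 0"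
instance ..
end

instantiation dual :: (ring_1) ring_1
begin

definition one_dual :: "'a dual" where "1 = Dual 1 0"
definition plus_dual :: "'a dual \<Rightarrow> 'a dual \<Rightarrow> 'a dual" where
  "x + y = Dual (st x + st y) (infp x + infp y)"
definition uminus_dual :: "'a dual \<Rightarrow> 'a dual" where
  "- x = Dual (- st x) (- infp x)"
definition minus_dual :: "'a dual \<Rightarrow> 'a dual \<Rightarrow> 'a dual" where
  "x - y = Dual (st x - st y) (infp x - infp y)"
definition times_dual :: "'a dual \<Rightarrow> 'a dual \<Rightarrow> 'a dual" where
  "x * y = Dual (st x * st y) (st x * infp y + infp x * st y)"

lemma dual_sel_simps [simp]:
  "st (0 :: 'a dual) = 0" "infp (0 :: 'a dual) = 0"
  "st (1 :: 'a dual) = 1" "infp (1 :: 'a dual) = 0"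
  "st (x + y) = st x + st y" "infp (x + y) = infp x + infp y"
  "st (- x) = - st x" "infp (- x) = - infp x"
  "st (x - y) = st x - st y" "infp (x - y) = infp x - infp y"
  "st (x * y) = st x * st y" "infp (x * y) = st x * infp y + infp x * st y"
  by (simp_all add: zero_dual_def one_dual_def plus_dual_def uminus_dual_def
      minus_dual_def times_dual_def)

instance
  by standard (simp_all add: dual_eq_iff algebra_simps)

end

instance dual :: (comm_ring_1) comm_ring_1
proof
  fix x y z :: "'a dual"
  show "x * y = y * x"
    unfolding dual_eq_iff dual_sel_simps by (simp only: mult.commute add.commute)
  show "1 * x = x"
    by (rule mult_1_left)
  show "(x + y) * z = x * z + y * z"
    by (rule distrib_right)
qed

instantiation dual :: (linorder) linorder
begin

definition less_dual :: "'a dual \<Rightarrow> 'a dual \<Rightarrow> bool" where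
  "x < y \<longleftrightarrow> st x < st y \<or> st x = st y \<and> infp x < infp y"
definition less_eq_dual :: "'a dual \<Rightarrow> 'a dual \<Rightarrow> bool" where
  "x \<le> y \<longleftrightarrow> x < y \<or> x = (y :: 'a dual)"

instance
  by standard (auto simp: less_dual_def less_eq_dual_def dual_eq_iff)

end

instantiation dual :: (conjugate) conjugate
begin

definition conjugate_dual :: "'a dual \<Rightarrow> 'a dual" where
  "conjugate x = Dual (conjugate (st x)) (conjugate (infp x))"

instance
  by standard (auto simp: dual_eq_iff conjugate_dual_def)

end

text \<open>Only meaningful for positive appreciable arguments and for 0 (where it is 0, since
  division by 0 yields 0).\<close>
definition dual_sqrt :: "dual_real \<Rightarrow> dual_real" where
  "dual_sqrt q = Dual (sqrt (st q)) (infp q / (2 * sqrt (st q)))"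

text \<open>The numerator of the dual part is a quaternion with vanishing imaginary parts; taking
  \<^const>\<open>qre\<close> merely retypes it as a real number.\<close>
definition dq_abs :: "dual_quat \<Rightarrow> dual_real" where
  "dq_abs q =
     (if st q \<noteq> 0
      then Dual (norm (st q))
             (qre (st q * conjugate (infp q) + infp q * conjugate (st q)) / (2 * norm (st q)))
      else Dual 0 (norm (infp q)))"

definition dq_of_dual :: "dual_real \<Rightarrow> dual_quat" where
  "dq_of_dual q = Dual (of_real (st q)) (of_real (infp q))"


section \<open>Dual quaternion vectors and matrices\<close>

definition dq_vec_norm :: "dual_quat vec \<Rightarrow> dual_real" where
  "dq_vec_norm x =
     (if map_vec st x \<noteq> 0\<^sub>v (dim_vec x)
      then dual_sqrt (\<Sum>i<dim_vec x. (dq_abs (x $ i))\<^sup>2)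
      else Dual 0 (sqrt (\<Sum>i<dim_vec x. (norm (infp (x $ i)))\<^sup>2)))"

definition dq_adjoint :: "dual_quat mat \<Rightarrow> dual_quat mat" where
  "dq_adjoint A = mat (dim_col A) (dim_row A) (\<lambda>(i, j). conjugate (A $$ (j, i)))"

definition dq_unitary :: "nat \<Rightarrow> dual_quat mat \<Rightarrow> bool" where
  "dq_unitary n U \<longleftrightarrow>
     U \<in> carrier_mat n n \<and> dq_adjoint U * U = 1\<^sub>m n \<and> U * dq_adjoint U = 1\<^sub>m n"

definition dq_svd ::
  "dual_quat mat \<Rightarrow> dual_quat mat \<Rightarrow> dual_real mat \<Rightarrow> dual_quat mat \<Rightarrow> bool" where
  "dq_svd A U S V \<longleftrightarrow>
     dq_unitary (dim_row A) U \<and> dq_unitary (dim_col A) V \<and>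
     S \<in> carrier_mat (dim_row A) (dim_col A) \<and> diagonal_mat S \<and>
     (\<forall>i < min (dim_row A) (dim_col A). 0 \<le> S $$ (i, i)) \<and>
     (\<forall>i j. i \<le> j \<longrightarrow> j < min (dim_row A) (dim_col A) \<longrightarrow> S $$ (j, j) \<le> S $$ (i, i)) \<and>
     A = U * map_mat dq_of_dual S * dq_adjoint V"

text \<open>Singular values are numbered from 1, matrix entries from 0. The diagonal of the middle
  factor does not depend on the chosen decomposition, which justifies the definite description.\<close>
definition singular_value :: "dual_quat mat \<Rightarrow> nat \<Rightarrow> dual_real" where
  "singular_value A k = (THE s. \<exists>U S V. dq_svd A U S V \<and> s = S $$ (k - 1, k - 1))"

definition spectral_norm :: "dual_quat mat \<Rightarrow> dual_real" where
  "spectral_norm A =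
     (GREATEST d. \<exists>x \<in> carrier_vec (dim_col A). dq_vec_norm x = 1 \<and> d = dq_vec_norm (A *\<^sub>v x))"

end

theory Submission
  imports "HOL-Analysis.Function_Topology" Defs
begin

text \<open>
If \<open>A = U \<Sigma> V\<^sup>*\<close> is a singular value decomposition, then unitary invariance of the norm turns
\<open>\<parallel>A x\<parallel>\<close> into \<open>\<parallel>\<Sigma> y\<parallel>\<close> with \<open>y = V\<^sup>* x\<close>, again a unit vector. On unit vectors \<open>\<parallel>\<Sigma> y\<parallel>\<close> is at most the leading
diagonal entry, with equality at the first unit vector (\<open>dq_vec_norm_unitary\<close>, \<open>diagonal_norm_le\<close>,
\<open>diagonal_norm_unit_vec\<close>). The leading entry is therefore a maximum that depends on \<open>A\<close> alone. This
identifies it with the spectral norm and shows that it is the same in every decomposition, so that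
the definite description of the first singular value denotes it.

The bulk of the work is the existence of a decomposition. Write \<open>A = A\<^sub>0 + A\<^sub>1\<epsilon>\<close>. Two quaternion
matrices \<open>X\<close> and \<open>Y\<close> have a simultaneous singular value decomposition, with real but possibly
negative values for \<open>Y\<close>, if \<open>X\<^sup>* Y\<close> and \<open>X Y\<^sup>*\<close> are Hermitian (\<open>joint_svd_exists\<close>). It is found by
splitting off, again and again, a common singular pair that is largest in the lexicographic order; such a
pair comes from maximizing a quadratic form on the unit sphere, and then a second one on the unit sphere of
the top eigenspace (\<open>top_eigenvector\<close>, \<open>top_common_singular\<close>). With \<open>X = A\<^sub>0\<close> and \<open>Y = 0\<close> this diagonalizes \<open>A\<^sub>0\<close>. Once
\<open>A\<^sub>0\<close> is diagonal, unitary matrices of the form \<open>I + K\<epsilon>\<close> move \<open>A\<^sub>1\<close> to a matrix that satisfies the two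
Hermitian conditions with \<open>A\<^sub>0\<close> (\<open>infinitesimal_rotation_to_hermitian\<close>), and a simultaneous
decomposition of the two parts is a decomposition of the dual matrix. Its lexicographic order is the order of
the dual numbers.
\<close>

section \<open>Adjoints and unitary matrices over a ring with involution\<close>

text \<open>Both the quaternions and the dual quaternions are rings in which conjugation reverses products, so
adjoints and unitary matrices are treated once for this class.\<close>
class star_ring = ring_1 + conjugate +
  assumes star_add: "conjugate (a + b) = conjugate a + conjugate b"
    and star_mult: "conjugate (a * b) = conjugate b * conjugate a"
begin

lemma star_zero [simp]: "conjugate 0 = 0"
  using star_add[of 0 0] by simp

lemma star_one [simp]: "conjugate 1 = 1"
  using star_mult[of "conjugate 1" 1] by simp

lemma star_uminus [simp]: "conjugate (- a) = - conjugate a"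
  using star_add[of "- a" a] by (simp add: eq_neg_iff_add_eq_0)

lemma star_minus: "conjugate (a - b) = conjugate a - conjugate b"
  using star_add[of a "- b"] by simp

lemma star_sum: "conjugate (sum f I) = (\<Sum>i\<in>I. conjugate (f i))"
  by (induction I rule: infinite_finite_induct) (simp_all add: star_add)

end

instance quat :: star_ring
  by standard (simp_all add: quat_eq_iff conjugate_quat_def quat_times_sel)

instance dual :: (star_ring) star_ring
  by standard (simp_all add: dual_eq_iff conjugate_dual_def star_add star_mult add.commute)

definition adj :: "'a::conjugate mat \<Rightarrow> 'a mat" where
  "adj A = mat (dim_col A) (dim_row A) (\<lambda>(i, j). conjugate (A $$ (j, i)))"

definition unitary :: "nat \<Rightarrow> 'a::star_ring mat \<Rightarrow> bool" where
  "unitary n U \<longleftrightarrow> U \<in> carrier_mat n n \<and> adj U * U = 1\<^sub>m n \<and> U * adj U = 1\<^sub>m n"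

lemma dq_adjoint_eq_adj: "dq_adjoint = adj"
  by (simp add: fun_eq_iff dq_adjoint_def adj_def)

lemma dq_unitary_eq_unitary: "dq_unitary = unitary"
  by (simp add: fun_eq_iff dq_unitary_def unitary_def dq_adjoint_eq_adj)

lemma adj_dim [simp]: "dim_row (adj A) = dim_col A" "dim_col (adj A) = dim_row A"
  by (simp_all add: adj_def)

lemma adj_carrier [simp]: "adj A \<in> carrier_mat n m \<longleftrightarrow> A \<in> carrier_mat m n"
  unfolding carrier_mat_def by auto

lemma index_adj [simp]:
  "i < dim_col A \<Longrightarrow> j < dim_row A \<Longrightarrow> adj A $$ (i, j) = conjugate (A $$ (j, i))"
  by (simp add: adj_def)

lemma adj_adj [simp]: "adj (adj A) = A"
  by (rule eq_matI) auto

lemma adj_mult: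
  fixes A B :: "'a::star_ring mat"
  assumes "A \<in> carrier_mat a b" "B \<in> carrier_mat b c"
  shows "adj (A * B) = adj B * adj A"
  using assms
  by (intro eq_matI) (auto simp: scalar_prod_def star_sum star_mult intro!: sum.cong)

lemma adj_one [simp]: "adj (1\<^sub>m n :: 'a::star_ring mat) = 1\<^sub>m n"
  by (rule eq_matI) auto

lemma adj_zero [simp]: "adj (0\<^sub>m m n :: 'a::star_ring mat) = 0\<^sub>m n m"
  by (rule eq_matI) auto

lemma adj_minus:
  fixes A B :: "'a::star_ring mat"
  assumes "A \<in> carrier_mat m n" "B \<in> carrier_mat m n"
  shows "adj (A - B) = adj A - adj B"
  using assms by (intro eq_matI) (auto simp: star_minus)

lemma adj_uminus: "adj (- A) = - adj (A :: 'a::star_ring mat)"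
  by (rule eq_matI) auto

lemma unitaryD:
  assumes "unitary n U"
  shows "U \<in> carrier_mat n n" "adj U \<in> carrier_mat n n" "adj U * U = 1\<^sub>m n" "U * adj U = 1\<^sub>m n"
  using assms by (auto simp: unitary_def)

lemma unitary_one [simp]: "unitary n (1\<^sub>m n)"
  by (simp add: unitary_def)

lemma unitary_adj: "unitary n U \<Longrightarrow> unitary n (adj U)"
  by (simp add: unitary_def)

lemma unitary_mult:
  fixes U V :: "'a::star_ring mat"
  assumes "unitary n U" "unitary n V"
  shows "unitary n (U * V)"
proof -
  note U = unitaryD[OF assms(1)] and V = unitaryD[OF assms(2)]
  have a: "adj (U * V) = adj V * adj U"
    using U V by (intro adj_mult) auto
  have "(adj V * adj U) * (U * V) = adj V * (adj U * (U * V))"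
    using U V by (intro assoc_mult_mat) auto
  also have "adj U * (U * V) = (adj U * U) * V"
    using U V by (intro assoc_mult_mat[symmetric]) auto
  finally have 1: "(adj V * adj U) * (U * V) = 1\<^sub>m n"
    using U V by simp
  have "(U * V) * (adj V * adj U) = U * (V * (adj V * adj U))"
    using U V by (intro assoc_mult_mat) auto
  also have "V * (adj V * adj U) = (V * adj V) * adj U"
    using U V by (intro assoc_mult_mat[symmetric]) auto
  finally have 2: "(U * V) * (adj V * adj U) = 1\<^sub>m n"
    using U V by simp
  from 1 2 show ?thesis
    using U V by (simp add: unitary_def a)
qed

abbreviation corner :: "'a::zero \<Rightarrow> nat \<Rightarrow> nat \<Rightarrow> 'a mat \<Rightarrow> 'a mat" where
  "corner c m n A \<equiv> four_block_mat (mat 1 1 (\<lambda>_. c)) (0\<^sub>m 1 n) (0\<^sub>m m 1) A"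

lemma corner_mult:
  fixes A B :: "'a::star_ring mat"
  assumes "A \<in> carrier_mat m k" "B \<in> carrier_mat k n"
  shows "corner a m k A * corner b k n B = corner (a * b) m n (A * B)"
proof -
  have "mat 1 1 (\<lambda>_. a) * mat 1 1 (\<lambda>_. b) = mat 1 1 (\<lambda>_. a * b)"
    by (rule eq_matI) (auto simp: scalar_prod_def)
  with assms show ?thesis
    by (subst mult_four_block_mat[of _ 1 1 _ k _ m _ _ 1 _ n]) auto
qed

lemma adj_corner:
  fixes A :: "'a::star_ring mat"
  assumes "A \<in> carrier_mat m n"
  shows "adj (corner a m n A) = corner (conjugate a) n m (adj A)"
  using assms by (intro eq_matI) auto

lemma corner_one: "corner 1 n n (1\<^sub>m n) = (1\<^sub>m (Suc n) :: 'a::star_ring mat)"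
  by (rule eq_matI) auto

lemma unitary_corner:
  fixes U :: "'a::star_ring mat"
  assumes "unitary n U" "conjugate c * c = 1" "c * conjugate c = 1"
  shows "unitary (Suc n) (corner c n n U)"
proof -
  note U = unitaryD[OF assms(1)]
  have "adj (corner c n n U) = corner (conjugate c) n n (adj U)"
    by (rule adj_corner[OF U(1)])
  moreover have "corner (conjugate c) n n (adj U) * corner c n n U = 1\<^sub>m (Suc n)"
    by (simp only: corner_mult[OF U(2,1)] U(3) assms(2) corner_one)
  moreover have "corner c n n U * corner (conjugate c) n n (adj U) = 1\<^sub>m (Suc n)"
    by (simp only: corner_mult[OF U(1,2)] U(4) assms(3) corner_one)
  moreover have "corner c n n U \<in> carrier_mat (Suc n) (Suc n)"
    using four_block_carrier_mat[OF _ U(1), of "mat 1 1 (\<lambda>_. c)" 1 1] by simp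
  ultimately show ?thesis
    by (simp only: unitary_def)
qed

text \<open>The reflection \<open>I - v v\<^sup>*\<close> is Hermitian, and it is an involution as soon as \<open>v\<^sup>* v = 2\<close>. Scaling
\<open>v\<close> to have squared length 2 keeps scalars, which need not commute with matrices, out of the
formula.\<close>
lemma householder_unitary:
  fixes v :: "'a::star_ring mat"
  assumes v: "v \<in> carrier_mat n 1" and len: "adj v * v = 1\<^sub>m 1 + 1\<^sub>m 1"
  shows "unitary n (1\<^sub>m n - v * adj v)"
proof -
  define W where "W = v * adj v"
  have W: "W \<in> carrier_mat n n" using v by (simp add: W_def)
  have adjW: "adj W = W" using v by (simp add: W_def adj_mult[of v n 1 "adj v" n])
  have "W * W = v * (adj v * (v * adj v))"
    unfolding W_def using v by (intro assoc_mult_mat[of _ n 1 _ n _ n]) auto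
  also have "adj v * (v * adj v) = (adj v * v) * adj v"
    using v by (intro assoc_mult_mat[symmetric, of _ 1 n _ 1 _ n]) auto
  also have "\<dots> = adj v + adj v"
    using v by (simp add: len add_mult_distrib_mat[of _ 1 1 _ _ n])
  also have "v * (adj v + adj v) = W + W"
    using v by (simp add: mult_add_distrib_mat[of _ n 1 _ n] W_def)
  finally have WW: "W * W = W + W" .
  define H where "H = 1\<^sub>m n - W"
  have H: "H \<in> carrier_mat n n" using W by (simp add: H_def minus_carrier_mat)
  have "H * W = W - W * W"
    unfolding H_def using W by (subst minus_mult_distrib_mat[of _ n n _ _ n]) auto
  moreover have "H * H = H * 1\<^sub>m n - H * W"
    using H W by (subst (2) H_def, subst mult_minus_distrib_mat[of _ n n _ n]) auto
  ultimately have "H * H = H - (W - (W + W))"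
    using H by (simp add: WW right_mult_one_mat[OF H])
  also have "\<dots> = 1\<^sub>m n"
    using W by (intro eq_matI) (auto simp: H_def)
  finally have HH: "H * H = 1\<^sub>m n" .
  have "adj H = H"
    using W by (simp add: H_def adj_minus[of _ n n] adjW)
  with H HH show ?thesis
    by (simp add: unitary_def W_def[symmetric] H_def[symmetric])
qed

section \<open>The real inner product of quaternion vectors\<close>

lemma quat_conjugate_mult [simp]:
  "conjugate q * q = of_real ((norm (q::quat))\<^sup>2)" "q * conjugate q = of_real ((norm q)\<^sup>2)"
  by (simp_all add: quat_eq_iff quat_times_sel conjugate_quat_def norm_quat_def power2_eq_square
      of_real_def scaleR_quat_def)

lemma conjugate_of_real [simp]: "conjugate (of_real r :: quat) = of_real r"
  by (simp add: of_real_def scaleR_quat_def conjugate_quat_def quat_eq_iff)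

lemma norm_conjugate_quat [simp]: "norm (conjugate q) = norm (q::quat)"
  by (simp add: norm_quat_def conjugate_quat_def)

lemma inner_mult_left_quat: "inner (a * b) (c::quat) = inner b (conjugate a * c)"
  by (simp add: inner_quat_def conjugate_quat_def quat_times_sel algebra_simps)

text \<open>For quaternion vectors this is the real part of \<open>x\<^sup>* y\<close>. The real part is all that the variational
arguments below need, and it keeps them free of noncommuting scalars.\<close>
definition vinner :: "'a::real_inner vec \<Rightarrow> 'a vec \<Rightarrow> real" where
  "vinner x y = (\<Sum>i<dim_vec x. inner (x $ i) (y $ i))"

lemma vinner_commute: "dim_vec x = dim_vec y \<Longrightarrow> vinner x y = vinner y x"
  by (simp add: vinner_def inner_commute)

lemma vinner_add_left:
  assumes "x \<in> carrier_vec n" "y \<in> carrier_vec n"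
  shows "vinner (x + y) z = vinner x z + vinner y z"
  using assms by (auto simp: vinner_def inner_add_left sum.distrib)

lemma vinner_add_right:
  assumes "x \<in> carrier_vec n" "y \<in> carrier_vec n" "z \<in> carrier_vec n"
  shows "vinner z (x + y) = vinner z x + vinner z y"
  using assms by (auto simp: vinner_def inner_add_right sum.distrib)

lemma vinner_diff_right:
  assumes "x \<in> carrier_vec n" "y \<in> carrier_vec n" "z \<in> carrier_vec n"
  shows "vinner z (x - y) = vinner z x - vinner z y"
  using assms by (auto simp: vinner_def inner_diff_right sum_subtractf)

lemma mult_of_real_quat: "q * of_real r = r *\<^sub>R (q :: quat)"
  by (simp add: of_real_def)

lemma of_real_mult_quat: "of_real r * q = r *\<^sub>R (q :: quat)"
  by (simp add: of_real_def)

lemma vinner_smult_left: "vinner (of_real r \<cdot>\<^sub>v x) y = r * vinner x (y :: quat vec)"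
  by (simp add: vinner_def of_real_mult_quat sum_distrib_left)

lemma vinner_smult_right:
  "dim_vec x = dim_vec y \<Longrightarrow> vinner x (of_real r \<cdot>\<^sub>v y) = r * vinner x (y :: quat vec)"
  by (simp add: vinner_def of_real_mult_quat sum_distrib_left)

lemma vinner_nonneg [simp]: "0 \<le> vinner x x"
  by (simp add: vinner_def sum_nonneg)

lemma vinner_eq_0_iff: "x \<in> carrier_vec n \<Longrightarrow> vinner x x = 0 \<longleftrightarrow> x = 0\<^sub>v n"
  by (auto simp: vinner_def sum_nonneg_eq_0_iff vec_eq_iff)

lemma vinner_zero_left [simp]: "vinner (0\<^sub>v n) y = 0"
  by (simp add: vinner_def)

lemma vinner_unit_vec [simp]: "i < n \<Longrightarrow> vinner (unit_vec n i) (unit_vec n i :: quat vec) = 1"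
  by (simp add: vinner_def inner_quat_def if_distrib[of "\<lambda>x. _ x * _ x"] unit_vec_def cong: if_cong)

lemma mult_mat_vec_of_real:
  assumes "(A::quat mat) \<in> carrier_mat m n" "x \<in> carrier_vec n"
  shows "A *\<^sub>v (of_real r \<cdot>\<^sub>v x) = of_real r \<cdot>\<^sub>v (A *\<^sub>v x)"
  using assms
  by (intro eq_vecI) (auto simp: scalar_prod_def of_real_mult_quat scaleR_sum_right)

lemma vinner_adj:
  fixes A :: "quat mat"
  assumes A: "A \<in> carrier_mat m n" and x: "x \<in> carrier_vec n" and y: "y \<in> carrier_vec m"
  shows "vinner (A *\<^sub>v x) y = vinner x (adj A *\<^sub>v y)"
proof -
  have "vinner (A *\<^sub>v x) y = (\<Sum>i<m. \<Sum>j<n. inner (A $$ (i, j) * x $ j) (y $ i))"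
    using A x y by (auto simp: vinner_def scalar_prod_def inner_sum_left lessThan_atLeast0 intro!: sum.cong)
  also have "\<dots> = (\<Sum>j<n. \<Sum>i<m. inner (A $$ (i, j) * x $ j) (y $ i))"
    by (rule sum.swap)
  also have "\<dots> = vinner x (adj A *\<^sub>v y)"
    using A x y
    by (auto simp: vinner_def scalar_prod_def inner_sum_right lessThan_atLeast0 inner_mult_left_quat
        intro!: sum.cong)
  finally show ?thesis .
qed

lemma unitary_vinner:
  assumes U: "unitary n (U::quat mat)" and xy: "x \<in> carrier_vec n" "y \<in> carrier_vec n"
  shows "vinner (U *\<^sub>v x) (U *\<^sub>v y) = vinner x y"
proof -
  note UD = unitaryD[OF U]
  have "vinner (U *\<^sub>v x) (U *\<^sub>v y) = vinner x (adj U *\<^sub>v (U *\<^sub>v y))"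
    using UD xy by (intro vinner_adj) auto
  also have "adj U *\<^sub>v (U *\<^sub>v y) = (adj U * U) *\<^sub>v y"
    using UD xy by (intro assoc_mult_mat_vec[symmetric]) auto
  finally show ?thesis using UD xy by simp
qed

section \<open>Unitary quaternion matrices with a prescribed first column\<close>

lemma quat_polar: "\<exists>q::quat. norm q = 1 \<and> a = of_real (norm a) * q"
proof (cases "a = 0")
  case False
  then show ?thesis
    by (intro exI[of _ "(1 / norm a) *\<^sub>R a"]) (simp add: of_real_def)
qed (auto intro: exI[of _ 1])

text \<open>A reflection can only send \<open>e\<^sub>0\<close> to a vector with real leading entry. So \<open>x\<close> is first
multiplied from the right by the conjugate of the phase \<open>q\<close> of its leading entry; the reflection
along \<open>x \<cdot> conjugate q + e\<^sub>0\<close> then sends \<open>e\<^sub>0\<close> to \<open>- x \<cdot> conjugate q\<close>, and a diagonal factor with leading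
entry \<open>- q\<close> restores \<open>x\<close>. Adding \<open>e\<^sub>0\<close>, not subtracting it, keeps the length of the vector away
from 0.\<close>
lemma unit_vector_is_first_column:
  fixes x :: "quat vec"
  assumes x: "x \<in> carrier_vec n" and n: "0 < n" and unit: "vinner x x = 1"
  shows "\<exists>V. unitary n V \<and> col V 0 = x"
proof -
  obtain q where q: "norm q = 1" "x $ 0 = of_real (norm (x $ 0)) * q"
    using quat_polar by blast
  define r where "r = norm (x $ 0)"
  define s where "s = sqrt (1 + r)"
  have r: "0 \<le> r" and s: "s > 0" "s\<^sup>2 = 1 + r" by (simp_all add: r_def s_def add_pos_nonneg)
  define e where "e i = (if i = 0 then 1 else 0 :: quat)" for i :: nat
  define w where "w i = (x $ i * conjugate q + e i) * of_real (1 / s)" for i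
  define v where "v = mat n 1 (\<lambda>(i, j). w i)"
  have q': "q * conjugate q = 1" "conjugate q * q = 1" by (simp_all add: q)
  \<comment> \<open>The leading entry of the rotated vector is the real number \<open>r\<close>, so
    \<open>w\<close> has squared length \<open>(1 + 2 r + 1) / (1 + r) = 2\<close>.\<close>
  have x0: "x $ 0 * conjugate q = of_real r"
    unfolding r_def by (subst q(2)) (simp add: mult.assoc q(1))
  have w0: "w 0 = of_real s"
  proof -
    have "w 0 = of_real ((r + 1) * (1 / s))"
      by (simp only: w_def e_def x0 of_real_mult of_real_add of_real_1 if_True simp_thms)
    also have "(r + 1) * (1 / s) = s"
      using s by (simp add: field_simps power2_eq_square)
    finally show ?thesis .
  qed
  have w_norm: "(norm (w i))\<^sup>2 = (inner (x $ i) (x $ i) + (if i = 0 then 2 * r + 1 else 0)) / s\<^sup>2" for i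
  proof (cases "i = 0")
    case True
    have "norm (w 0) = s" using s by (simp add: w0)
    moreover have "inner (x $ 0) (x $ 0) = r\<^sup>2" by (simp add: r_def power2_norm_eq_inner)
    moreover have "s\<^sup>2 * s\<^sup>2 = r\<^sup>2 + (2 * r + 1)"
      unfolding s(2) by (simp add: power2_eq_square algebra_simps)
    ultimately show ?thesis using True s(1)
      by (simp add: field_simps)
  next
    case False
    then show ?thesis using s(1)
      by (simp add: w_def e_def norm_quat_mult q(1) power_divide power2_norm_eq_inner power_mult_distrib)
  qed
  have "(\<Sum>i<n. (norm (w i))\<^sup>2) = ((\<Sum>i<n. inner (x $ i) (x $ i)) + (\<Sum>i<n. if i = 0 then 2 * r + 1 else 0)) / s\<^sup>2"
    unfolding w_norm by (simp add: sum.distrib flip: sum_divide_distrib)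
  also have "\<dots> = (1 + (2 * r + 1)) / s\<^sup>2"
    using unit x n by (simp add: vinner_def)
  also have "\<dots> = 2" using r by (simp add: s field_simps)
  finally have w_sum: "(\<Sum>i<n. (norm (w i))\<^sup>2) = 2" .
  have v: "v \<in> carrier_mat n 1" by (simp add: v_def)
  have "adj v * v = 1\<^sub>m 1 + 1\<^sub>m 1"
  proof (rule eq_matI)
    fix i j assume "i < dim_row (1\<^sub>m 1 + 1\<^sub>m 1 :: quat mat)" "j < dim_col (1\<^sub>m 1 + 1\<^sub>m 1 :: quat mat)"
    then have ij: "i = 0" "j = 0" by simp_all
    have "(adj v * v) $$ (i, j) = (\<Sum>k<n. of_real ((norm (w k))\<^sup>2))"
      using ij by (simp add: scalar_prod_def v_def lessThan_atLeast0)
    also have "\<dots> = 2" by (simp only: w_sum of_real_numeral flip: of_real_sum)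
    finally show "(adj v * v) $$ (i, j) = (1\<^sub>m 1 + 1\<^sub>m 1) $$ (i, j)" using ij by simp
  qed (simp_all add: v_def)
  then have "unitary n (1\<^sub>m n - v * adj v)" by (rule householder_unitary[OF v])
  moreover define H where "H = 1\<^sub>m n - v * adj v"
  ultimately have H: "unitary n H" by simp
  note HC = unitaryD(1)[OF H]
  obtain k where k: "n = Suc k" using n by (cases n) auto
  define D where "D = corner (- q) k k (1\<^sub>m k)"
  have D: "unitary n D" unfolding D_def k by (rule unitary_corner) (simp_all add: q)
  note DC = unitaryD(1)[OF D]
  have colD: "col D 0 = vec n (\<lambda>i. if i = 0 then - q else 0)"
    by (rule eq_vecI) (auto simp: D_def k)
  \<comment> \<open>\<open>H e\<^sub>0 = - x \<cdot> conjugate q\<close>, and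
    \<open>D e\<^sub>0 = - e\<^sub>0 \<cdot> q\<close>.\<close>
  have "col (H * D) 0 = x"
  proof (rule eq_vecI)
    fix i assume "i < dim_vec x"
    then have i: "i < n" using x by simp
    have "col (H * D) 0 $ i = row H i \<bullet> col D 0"
      using HC DC i n by simp
    also have "\<dots> = H $$ (i, 0) * (- q)"
      using i n HC by (simp add: colD scalar_prod_def if_distrib[of "(*) _"] cong: if_cong)
    also have "H $$ (i, 0) = e i - w i * of_real s"
      using i n by (simp add: H_def v_def scalar_prod_def e_def w0)
    also have "w i * of_real s = x $ i * conjugate q + e i"
      using s(1) by (simp add: w_def mult.assoc flip: of_real_mult)
    finally show "col (H * D) 0 $ i = x $ i"
      by (simp add: mult.assoc q(1))
  qed (use x HC in auto)
  with unitary_mult[OF H D] show ?thesis by blast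
qed

section \<open>Top eigenvectors of Hermitian quaternion matrices\<close>

lemma compact_unit_ball_quat: "compact ({q::quat. norm q \<le> 1})"
proof -
  define f where "f = (\<lambda>(a, b, c, d). a *\<^sub>R Quat 1 0 0 0 + b *\<^sub>R Quat 0 1 0 0
    + c *\<^sub>R Quat 0 0 1 0 + d *\<^sub>R Quat 0 0 0 1)"
  let ?I = "{- 1..1::real}"
  have "compact (f ` (?I \<times> ?I \<times> ?I \<times> ?I))"
    unfolding f_def case_prod_unfold
    by (intro compact_continuous_image continuous_intros compact_Times compact_Icc)
  moreover have "{q::quat. norm q \<le> 1} \<subseteq> f ` (?I \<times> ?I \<times> ?I \<times> ?I)"
  proof
    fix q :: quat assume "q \<in> {q::quat. norm q \<le> 1}"
    then have "(qre q)\<^sup>2 + (qi q)\<^sup>2 + (qj q)\<^sup>2 + (qk q)\<^sup>2 \<le> 1"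
      by (simp add: norm_quat_def)
    then have "(qre q)\<^sup>2 \<le> 1" "(qi q)\<^sup>2 \<le> 1" "(qj q)\<^sup>2 \<le> 1" "(qk q)\<^sup>2 \<le> 1"
      using zero_le_power2[of "qre q"] zero_le_power2[of "qi q"] zero_le_power2[of "qj q"]
        zero_le_power2[of "qk q"] by linarith+
    then have "(qre q, qi q, qj q, qk q) \<in> ?I \<times> ?I \<times> ?I \<times> ?I"
      by (simp add: abs_square_le_1 abs_le_iff)
    moreover have "q = f (qre q, qi q, qj q, qk q)"
      by (simp add: f_def quat_eq_iff scaleR_quat_def)
    ultimately show "q \<in> f ` (?I \<times> ?I \<times> ?I \<times> ?I)" by blast
  qed
  moreover have "closed {q::quat. norm q \<le> 1}"
    by (intro closed_Collect_le continuous_intros)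
  ultimately show ?thesis
    by (metis compact_Int_closed inf.absorb_iff2)
qed

text \<open>Vectors of length \<open>n\<close> carry no topology, so the unit sphere of the kernel of \<open>M\<close> is moved into the
product space of all sequences of quaternions (padded with zeros from index \<open>n\<close> on), where it is a
closed subset of a power of the unit ball and hence compact by the theorem of Tychonoff.\<close>
lemma quadratic_form_attains_max:
  fixes G M :: "quat mat"
  assumes G: "G \<in> carrier_mat n n" and M: "M \<in> carrier_mat k n"
    and z: "z \<in> carrier_vec n" "M *\<^sub>v z = 0\<^sub>v k" "vinner z z = 1"
  shows "\<exists>x\<in>carrier_vec n. M *\<^sub>v x = 0\<^sub>v k \<and> vinner x x = 1 \<and>
    (\<forall>y\<in>carrier_vec n. M *\<^sub>v y = 0\<^sub>v k \<longrightarrow> vinner y y = 1 \<longrightarrow>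
      vinner y (G *\<^sub>v y) \<le> vinner x (G *\<^sub>v x))"
proof -
  define Q where "Q f = (\<Sum>i<n. inner (f i) (\<Sum>j<n. G $$ (i, j) * f j))" for f :: "nat \<Rightarrow> quat"
  define N where "N f = (\<Sum>i<n. inner (f i) (f i))" for f :: "nat \<Rightarrow> quat"
  define R where "R i f = (\<Sum>j<n. M $$ (i, j) * f j)" for i and f :: "nat \<Rightarrow> quat"
  define K where "K = (\<Inter>i\<in>{n..}. {f. f i = 0}) \<inter> {f. N f = 1} \<inter> (\<Inter>i\<in>{..<k}. {f. R i f = 0})"
  note continuous_on_inner' = bounded_bilinear.continuous_on[OF bounded_bilinear_inner]
  have coord: "continuous_on UNIV (\<lambda>f::nat \<Rightarrow> quat. f i)" for i by simp
  have Q_cont: "continuous_on S Q" for S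
    by (rule continuous_on_subset[of UNIV])
      (unfold Q_def, intro continuous_intros continuous_on_inner' coord, simp)
  have "closed K"
    unfolding K_def N_def R_def
    by (intro closed_Int closed_INT ballI closed_Collect_eq continuous_intros continuous_on_inner' coord)
  moreover have "compact (PiE UNIV (\<lambda>_::nat. {q::quat. norm q \<le> 1}))"
    using compactin_PiE[of "\<lambda>_::nat. euclidean" UNIV "\<lambda>_. {q::quat. norm q \<le> 1}"]
    by (simp add: euclidean_product_topology compact_unit_ball_quat)
  moreover have "K \<subseteq> PiE UNIV (\<lambda>_. {q::quat. norm q \<le> 1})"
  proof
    fix f assume f: "f \<in> K"
    have "norm (f i) \<le> 1" for i
    proof (cases "i < n")
      case True
      then have "inner (f i) (f i) \<le> N f"
        unfolding N_def by (intro member_le_sum) auto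
      then have "(norm (f i))\<^sup>2 \<le> 1" using f by (simp add: K_def power2_norm_eq_inner)
      then show ?thesis by (simp add: abs_square_le_1)
    qed (use f in \<open>auto simp: K_def\<close>)
    then show "f \<in> PiE UNIV (\<lambda>_. {q::quat. norm q \<le> 1})" by (simp add: PiE_iff)
  qed
  ultimately have "compact K" by (metis compact_Int_closed inf.absorb_iff2)
  have vecQ: "vinner y (G *\<^sub>v y) = Q (\<lambda>i. if i < n then y $ i else 0)"
    and vecN: "vinner y y = N (\<lambda>i. if i < n then y $ i else 0)"
    and vecR: "M *\<^sub>v y = 0\<^sub>v k \<longleftrightarrow> (\<forall>i<k. R i (\<lambda>i. if i < n then y $ i else 0) = 0)"
    if "y \<in> carrier_vec n" for y
    using that G M
    by (auto simp: vinner_def Q_def N_def R_def scalar_prod_def lessThan_atLeast0 vec_eq_iff)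
  have mem: "(\<lambda>i. if i < n then y $ i else 0) \<in> K"
    if "y \<in> carrier_vec n" "M *\<^sub>v y = 0\<^sub>v k" "vinner y y = 1" for y
    using that vecN[of y] vecR[of y] by (simp add: K_def)
  have "K \<noteq> {}" using mem[OF z] by blast
  then obtain f where f: "f \<in> K" and max: "\<And>g. g \<in> K \<Longrightarrow> Q g \<le> Q f"
    using continuous_attains_sup[OF \<open>compact K\<close> _ Q_cont] by blast
  define x where "x = vec n f"
  have xf: "(\<lambda>i. if i < n then x $ i else 0) = f"
    using f by (auto simp: x_def K_def fun_eq_iff)
  have x: "x \<in> carrier_vec n" by (simp add: x_def)
  show ?thesis
  proof (intro bexI[OF _ x] conjI ballI impI)
    show "M *\<^sub>v x = 0\<^sub>v k" "vinner x x = 1"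
      using f vecR[OF x] vecN[OF x] by (auto simp: xf K_def)
    fix y :: "quat vec" assume "y \<in> carrier_vec n" "M *\<^sub>v y = 0\<^sub>v k" "vinner y y = 1"
    then show "vinner y (G *\<^sub>v y) \<le> vinner x (G *\<^sub>v x)"
      using max[OF mem] vecQ[of y] vecQ[OF x] by (simp add: xf)
  qed
qed

text \<open>The first-order condition of a variational argument: a linear term that is bounded by a quadratic one
near 0 vanishes.\<close>
lemma nonneg_le_quadratic_imp_zero:
  fixes D c :: real
  assumes "0 \<le> D" and le: "\<And>t. 0 < t \<Longrightarrow> 2 * t * D \<le> t\<^sup>2 * c"
  shows "D = 0"
proof (rule ccontr)
  assume "D \<noteq> 0"
  with assms(1) have D: "D > 0" by simp
  \<comment> \<open>Small enough that the quadratic term \<open>t\<^sup>2 c\<close> is at most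
    \<open>t D\<close>.\<close>
  define t where "t = D / (\<bar>c\<bar> + 1)"
  have t: "t > 0" using D by (simp add: t_def)
  have "2 * D \<le> t * c" using le[OF t] t by (simp add: power2_eq_square)
  also have "\<dots> \<le> t * (\<bar>c\<bar> + 1)" using t by (intro mult_left_mono) auto
  also have "\<dots> = D" by (simp add: t_def)
  finally show False using D by simp
qed

text \<open>A maximizer \<open>x\<close> of the quadratic form of \<open>G\<close> on the unit sphere of an invariant subspace is an
eigenvector. The residual \<open>d = G x - \<mu> x\<close> stays in the subspace by invariance, and comparing the form
at \<open>x\<close> and at \<open>x + t d\<close> for small \<open>t\<close> forces \<open>d\<close> to be orthogonal to itself. Subspaces are given as
kernels because the lemma is applied to the whole space and to an eigenspace.\<close>
lemma top_eigenvector: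
  fixes G M :: "quat mat"
  assumes G: "G \<in> carrier_mat n n" "adj G = G" and M: "M \<in> carrier_mat k n"
    and inv: "\<And>y. y \<in> carrier_vec n \<Longrightarrow> M *\<^sub>v y = 0\<^sub>v k \<Longrightarrow> M *\<^sub>v (G *\<^sub>v y) = 0\<^sub>v k"
    and z: "z \<in> carrier_vec n" "M *\<^sub>v z = 0\<^sub>v k" "vinner z z = 1"
  obtains x \<mu> where "x \<in> carrier_vec n" "M *\<^sub>v x = 0\<^sub>v k" "vinner x x = 1"
    "G *\<^sub>v x = of_real \<mu> \<cdot>\<^sub>v x"
    "\<And>y. y \<in> carrier_vec n \<Longrightarrow> M *\<^sub>v y = 0\<^sub>v k \<Longrightarrow> vinner y (G *\<^sub>v y) \<le> \<mu> * vinner y y"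
proof -
  obtain x where x: "x \<in> carrier_vec n" "M *\<^sub>v x = 0\<^sub>v k" "vinner x x = 1"
    and max: "\<And>y. y \<in> carrier_vec n \<Longrightarrow> M *\<^sub>v y = 0\<^sub>v k \<Longrightarrow> vinner y y = 1 \<Longrightarrow>
      vinner y (G *\<^sub>v y) \<le> vinner x (G *\<^sub>v x)"
    using quadratic_form_attains_max[OF G(1) M z] by blast
  define \<mu> where "\<mu> = vinner x (G *\<^sub>v x)"
  have bound: "vinner y (G *\<^sub>v y) \<le> \<mu> * vinner y y"
    if y: "y \<in> carrier_vec n" "M *\<^sub>v y = 0\<^sub>v k" for y
  proof (cases "vinner y y = 0")
    case True
    then show ?thesis using y G by (simp add: vinner_eq_0_iff[of y n])
  next
    case False
    then have pos: "vinner y y > 0" using vinner_nonneg[of y] by linarith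
    define r where "r = 1 / sqrt (vinner y y)"
    have r: "r * r * vinner y y = 1" using pos by (simp add: r_def field_simps)
    define w where "w = of_real r \<cdot>\<^sub>v y"
    have w: "w \<in> carrier_vec n" using y by (simp add: w_def)
    have "vinner w w = 1"
      using r by (simp add: w_def vinner_smult_left vinner_smult_right mult.assoc)
    moreover have "M *\<^sub>v w = 0\<^sub>v k"
      using y M by (simp add: w_def mult_mat_vec_of_real[of M k n]) (auto simp: vec_eq_iff)
    ultimately have "vinner w (G *\<^sub>v w) \<le> \<mu>" using max[OF w] by (simp add: \<mu>_def)
    also have "vinner w (G *\<^sub>v w) = r * r * vinner y (G *\<^sub>v y)"
      using y G by (simp add: w_def mult_mat_vec_of_real[of G n n] vinner_smult_left vinner_smult_right)
    finally have "(r * r * vinner y y) * vinner y (G *\<^sub>v y) \<le> \<mu> * vinner y y"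
      using pos by (simp add: mult.commute mult.left_commute mult_left_mono)
    then show ?thesis by (simp add: r)
  qed
  define d where "d = G *\<^sub>v x - of_real \<mu> \<cdot>\<^sub>v x"
  have Gx: "G *\<^sub>v x \<in> carrier_vec n" and mx: "of_real \<mu> \<cdot>\<^sub>v x \<in> carrier_vec n"
    using G x by simp_all
  have d: "d \<in> carrier_vec n" using Gx mx by (simp add: d_def)
  have Gd: "G *\<^sub>v d \<in> carrier_vec n" using G d by simp
  have "M *\<^sub>v (of_real \<mu> \<cdot>\<^sub>v x) = 0\<^sub>v k"
    using x M by (simp add: mult_mat_vec_of_real[of M k n]) (auto simp: vec_eq_iff)
  then have Md: "M *\<^sub>v d = 0\<^sub>v k"
    using inv[OF x(1,2)] Gx mx M
    by (simp add: d_def mult_minus_distrib_mat_vec[of M k n])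
  have "vinner d d = 0"
  proof (rule nonneg_le_quadratic_imp_zero[where c = "\<mu> * vinner d d - vinner d (G *\<^sub>v d)"])
    fix t :: real
    define y where "y = x + of_real t \<cdot>\<^sub>v d"
    have td: "of_real t \<cdot>\<^sub>v d \<in> carrier_vec n" using d by simp
    have y: "y \<in> carrier_vec n" using x td by (simp add: y_def)
    have "M *\<^sub>v (of_real t \<cdot>\<^sub>v d) = 0\<^sub>v k"
      using d Md M by (simp add: mult_mat_vec_of_real[of M k n]) (auto simp: vec_eq_iff)
    then have My: "M *\<^sub>v y = 0\<^sub>v k"
      using x td M by (simp add: y_def mult_add_distrib_mat_vec[of M k n])
    have tGd: "of_real t \<cdot>\<^sub>v (G *\<^sub>v d) \<in> carrier_vec n" using Gd by simp
    have Gy: "G *\<^sub>v y = G *\<^sub>v x + of_real t \<cdot>\<^sub>v (G *\<^sub>v d)"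
      using G x d td by (simp add: y_def mult_add_distrib_mat_vec[of G n n] mult_mat_vec_of_real[of G n n])
    have xGd: "vinner x (G *\<^sub>v d) = vinner d (G *\<^sub>v x)"
      using vinner_adj[OF G(1) x(1) d] G Gx d by (simp add: vinner_commute[of d "G *\<^sub>v x"])
    have xd: "vinner x d = vinner d x" using x d by (simp add: vinner_commute)
    have "vinner y (G *\<^sub>v y) = \<mu> + 2 * t * vinner d (G *\<^sub>v x) + t\<^sup>2 * vinner d (G *\<^sub>v d)"
      unfolding Gy unfolding y_def using x d td Gx Gd tGd G(1)
      by (simp add: vinner_add_left[of _ n] vinner_add_right[of _ n]
          vinner_smult_left vinner_smult_right xGd power2_eq_square algebra_simps flip: \<mu>_def)
    moreover have "vinner y y = 1 + 2 * t * vinner d x + t\<^sup>2 * vinner d d"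
      using x d td
      by (simp add: y_def vinner_add_left[of _ n] vinner_add_right[of _ n]
          vinner_smult_left vinner_smult_right xd power2_eq_square algebra_simps)
    moreover have "vinner d (G *\<^sub>v x) = vinner d d + \<mu> * vinner d x"
      using vinner_diff_right[OF Gx mx d] x d by (simp add: vinner_smult_right flip: d_def)
    ultimately have "\<mu> + 2 * t * (vinner d d + \<mu> * vinner d x) + t\<^sup>2 * vinner d (G *\<^sub>v d)
        \<le> \<mu> * (1 + 2 * t * vinner d x + t\<^sup>2 * vinner d d)"
      using bound[OF y My] by metis
    then show "2 * t * vinner d d \<le> t\<^sup>2 * (\<mu> * vinner d d - vinner d (G *\<^sub>v d))"
      by (simp add: algebra_simps)
  qed simp
  then have "d = 0\<^sub>v n" using vinner_eq_0_iff[OF d] by simp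
  then have "G *\<^sub>v x = of_real \<mu> \<cdot>\<^sub>v x"
    using G(1) mx unfolding d_def by (auto simp: vec_eq_iff)
  from that[OF x this bound] show thesis .
qed

section \<open>Common singular vectors of two quaternion matrices\<close>

text \<open>\<open>x\<close> and \<open>u\<close> are a right and a left singular vector of \<open>A\<close> and of \<open>B\<close> at the same time. The two
values are packed into one dual number because the dual order is exactly the lexicographic order in
which such pairs are selected below.\<close>
definition common_singular ::
  "quat mat \<Rightarrow> quat mat \<Rightarrow> dual_real \<Rightarrow> quat vec \<Rightarrow> quat vec \<Rightarrow> bool" where
  "common_singular A B s x u \<longleftrightarrow>
     x \<in> carrier_vec (dim_col A) \<and> vinner x x = 1 \<and>
     u \<in> carrier_vec (dim_row A) \<and> vinner u u = 1 \<and>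
     A *\<^sub>v x = of_real (st s) \<cdot>\<^sub>v u \<and> adj A *\<^sub>v u = of_real (st s) \<cdot>\<^sub>v x \<and>
     B *\<^sub>v x = of_real (infp s) \<cdot>\<^sub>v u \<and> adj B *\<^sub>v u = of_real (infp s) \<cdot>\<^sub>v x"

lemma smult_cancel_quat:
  assumes "of_real r \<cdot>\<^sub>v x = of_real r \<cdot>\<^sub>v (y::quat vec)" "r \<noteq> 0"
  shows "x = y"
proof -
  have "of_real (1 / r) \<cdot>\<^sub>v (of_real r \<cdot>\<^sub>v x) = of_real (1 / r) \<cdot>\<^sub>v (of_real r \<cdot>\<^sub>v y)"
    using assms(1) by simp
  then show ?thesis
    using assms(2) by (simp add: smult_smult_assoc flip: of_real_mult)
qed

lemma vinner_gram:
  fixes A :: "quat mat"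
  assumes A: "A \<in> carrier_mat m n" and B: "B \<in> carrier_mat m n" and x: "x \<in> carrier_vec n"
  shows "vinner x ((adj A * B) *\<^sub>v x) = vinner (A *\<^sub>v x) (B *\<^sub>v x)"
proof -
  have "(adj A * B) *\<^sub>v x = adj A *\<^sub>v (B *\<^sub>v x)"
    using A B x by (intro assoc_mult_mat_vec) auto
  then show ?thesis
    using vinner_adj[OF A x, of "B *\<^sub>v x"] B x by simp
qed

lemma zero_mat_of_vinner:
  fixes A :: "quat mat"
  assumes A: "A \<in> carrier_mat m n"
    and zero: "\<And>y. y \<in> carrier_vec n \<Longrightarrow> vinner (A *\<^sub>v y) (A *\<^sub>v y) \<le> 0"
  shows "A = 0\<^sub>m m n"
proof (rule eq_matI)
  fix i j assume "i < dim_row (0\<^sub>m m n :: quat mat)" "j < dim_col (0\<^sub>m m n :: quat mat)"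
  then have ij: "i < m" "j < n" by simp_all
  have c: "A *\<^sub>v unit_vec n j \<in> carrier_vec m" using A by simp
  have "vinner (A *\<^sub>v unit_vec n j) (A *\<^sub>v unit_vec n j) = 0"
    using zero[of "unit_vec n j"] vinner_nonneg[of "A *\<^sub>v unit_vec n j"] by simp
  then have "A *\<^sub>v unit_vec n j = 0\<^sub>v m" by (simp add: vinner_eq_0_iff[OF c])
  moreover have "(A *\<^sub>v unit_vec n j) $ i = A $$ (i, j)"
    using A ij by (simp add: scalar_prod_right_unit)
  ultimately show "A $$ (i, j) = 0\<^sub>m m n $$ (i, j)" using ij by simp
qed (use A in auto)

text \<open>The right singular vector is a top eigenvector of \<open>A\<^sup>* A\<close>; the left one is its normalized image, or an
arbitrary unit vector when \<open>A\<close> vanishes.\<close>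
lemma top_singular_pair:
  fixes A :: "quat mat"
  assumes A: "A \<in> carrier_mat m n" and mn: "0 < m" "0 < n"
  obtains x u \<sigma> where "0 \<le> \<sigma>" "x \<in> carrier_vec n" "vinner x x = 1" "u \<in> carrier_vec m" "vinner u u = 1"
    "A *\<^sub>v x = of_real \<sigma> \<cdot>\<^sub>v u" "adj A *\<^sub>v u = of_real \<sigma> \<cdot>\<^sub>v x"
    "\<And>y. y \<in> carrier_vec n \<Longrightarrow> vinner (A *\<^sub>v y) (A *\<^sub>v y) \<le> \<sigma>\<^sup>2 * vinner y y"
proof -
  define H where "H = adj A * A"
  have H: "H \<in> carrier_mat n n" "adj H = H"
    using A by (simp_all add: H_def adj_mult[of "adj A" n m A n])
  obtain x l where x: "x \<in> carrier_vec n" "vinner x x = 1" and Hx: "H *\<^sub>v x = of_real l \<cdot>\<^sub>v x"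
    and max: "\<And>y. y \<in> carrier_vec n \<Longrightarrow> vinner y (H *\<^sub>v y) \<le> l * vinner y y"
  \<comment> \<open>The kernel of a matrix without rows is the whole space.\<close>
  proof (rule top_eigenvector[OF H, of "0\<^sub>m 0 n" 0 "unit_vec n 0"])
    fix x l assume "x \<in> carrier_vec n" "vinner x x = 1" "H *\<^sub>v x = of_real l \<cdot>\<^sub>v x"
      "\<And>y. y \<in> carrier_vec n \<Longrightarrow> 0\<^sub>m 0 n *\<^sub>v y = 0\<^sub>v 0 \<Longrightarrow> vinner y (H *\<^sub>v y) \<le> l * vinner y y"
    then show thesis by (intro that) (auto simp: vec_eq_iff)
  qed (use mn in \<open>auto simp: vec_eq_iff\<close>)
  have gram: "vinner (A *\<^sub>v y) (A *\<^sub>v y) = vinner y (H *\<^sub>v y)" if "y \<in> carrier_vec n" for y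
    using vinner_gram[OF A A that] by (simp add: H_def)
  have l: "l = vinner (A *\<^sub>v x) (A *\<^sub>v x)"
    using gram[OF x(1)] x by (simp add: Hx vinner_smult_right)
  define s where "s = sqrt l"
  have s: "0 \<le> s" "s\<^sup>2 = l" using l by (simp_all add: s_def)
  have bound: "vinner (A *\<^sub>v y) (A *\<^sub>v y) \<le> s\<^sup>2 * vinner y y" if "y \<in> carrier_vec n" for y
    using max[OF that] gram[OF that] s by simp
  have Hx': "H *\<^sub>v x = adj A *\<^sub>v (A *\<^sub>v x)"
    unfolding H_def using A x by (intro assoc_mult_mat_vec) auto
  show thesis
  proof (cases "s = 0")
    case True
    have "A = 0\<^sub>m m n"
      using bound True by (intro zero_mat_of_vinner[OF A]) auto
    then show thesis
      using x mn True bound by (intro that[of 0 x "unit_vec m 0"]) (auto simp: vec_eq_iff)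
  next
    case False
    define u where "u = of_real (1 / s) \<cdot>\<^sub>v (A *\<^sub>v x)"
    have u: "u \<in> carrier_vec m" using A x by (simp add: u_def)
    have "vinner u u = (1 / s) * (1 / s) * l"
      by (simp add: u_def vinner_smult_left vinner_smult_right flip: l)
    then have uu: "vinner u u = 1" using False by (simp add: s(2)[symmetric] power2_eq_square)
    have Ax: "A *\<^sub>v x = of_real s \<cdot>\<^sub>v u"
      using False by (simp add: u_def smult_smult_assoc flip: of_real_mult)
    have "adj A *\<^sub>v u = of_real (1 / s) \<cdot>\<^sub>v (adj A *\<^sub>v (A *\<^sub>v x))"
      unfolding u_def using A x by (intro mult_mat_vec_of_real) auto
    also have "\<dots> = of_real s \<cdot>\<^sub>v x"
      using False
      by (simp add: Hx'[symmetric] Hx smult_smult_assoc s(2)[symmetric] power2_eq_square flip: of_real_mult)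
    finally show thesis
      using that[OF s(1) x u uu Ax _ bound] by blast
  qed
qed

text \<open>The two conditions say that \<open>A\<^sup>* B\<close> and \<open>A B\<^sup>*\<close> are Hermitian, and they imply that \<open>A\<^sup>* B\<close> commutes with
\<open>A\<^sup>* A\<close>. Let \<open>\<sigma>\<close> be the largest singular value of \<open>A\<close>. If \<open>\<sigma> > 0\<close>, the top eigenspace of
\<open>A\<^sup>* A\<close> is invariant under \<open>A\<^sup>* B\<close>, and a top eigenvector of \<open>A\<^sup>* B\<close> in it, with eigenvalue \<open>\<mu>\<close>, is a
common singular vector with second value \<open>\<mu> / \<sigma>\<close>, possibly negative. If \<open>\<sigma> = 0\<close>, then \<open>A\<close>
vanishes and \<open>B\<close> alone decides. Any other common pair is dominated first in \<open>\<sigma>\<close> and, when it ties,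
lies in that same eigenspace and is dominated in the second value.\<close>
lemma top_common_singular:
  fixes A B :: "quat mat"
  assumes A: "A \<in> carrier_mat m n" and B: "B \<in> carrier_mat m n" and mn: "0 < m" "0 < n"
    and AB: "adj A * B = adj B * A" and AB': "A * adj B = B * adj A"
  shows "\<exists>s x u. 0 \<le> s \<and> common_singular A B s x u \<and>
    (\<forall>s' y w. 0 \<le> s' \<longrightarrow> common_singular A B s' y w \<longrightarrow> s' \<le> s)"
proof -
  obtain x1 u1 \<sigma> where s: "0 \<le> \<sigma>" and x1: "x1 \<in> carrier_vec n" "vinner x1 x1 = 1"
      and u1: "u1 \<in> carrier_vec m"
      and Ax1: "A *\<^sub>v x1 = of_real \<sigma> \<cdot>\<^sub>v u1" and Au1: "adj A *\<^sub>v u1 = of_real \<sigma> \<cdot>\<^sub>v x1"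
      and A_le: "\<And>y. y \<in> carrier_vec n \<Longrightarrow> vinner (A *\<^sub>v y) (A *\<^sub>v y) \<le> \<sigma>\<^sup>2 * vinner y y"
    using top_singular_pair[OF A mn] by metis
  show ?thesis
  proof (cases "\<sigma> = 0")
    case True
    then have A0: "A = 0\<^sub>m m n"
      using A_le by (intro zero_mat_of_vinner[OF A]) auto
    obtain x u \<beta> where b: "0 \<le> \<beta>" and x: "x \<in> carrier_vec n" "vinner x x = 1"
      and u: "u \<in> carrier_vec m" "vinner u u = 1"
      and Bx: "B *\<^sub>v x = of_real \<beta> \<cdot>\<^sub>v u" and Bu: "adj B *\<^sub>v u = of_real \<beta> \<cdot>\<^sub>v x"
      and B_le: "\<And>y. y \<in> carrier_vec n \<Longrightarrow> vinner (B *\<^sub>v y) (B *\<^sub>v y) \<le> \<beta>\<^sup>2 * vinner y y"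
      using top_singular_pair[OF B mn] by metis
    have "common_singular A B (Dual 0 \<beta>) x u"
      using A0 x u Bx Bu by (auto simp: common_singular_def vec_eq_iff)
    moreover have "s' \<le> Dual 0 \<beta>" if s': "0 \<le> s'" "common_singular A B s' y w" for s' y w
    proof -
      have yw: "y \<in> carrier_vec n" "vinner y y = 1" "w \<in> carrier_vec m" "vinner w w = 1"
        and Ay: "0\<^sub>m m n *\<^sub>v y = of_real (st s') \<cdot>\<^sub>v w" and By: "B *\<^sub>v y = of_real (infp s') \<cdot>\<^sub>v w"
        using s'(2) A0 by (auto simp: common_singular_def)
      have "0\<^sub>v m = of_real (st s') \<cdot>\<^sub>v w" using Ay yw(1) by (auto simp: vec_eq_iff)
      then have "vinner (of_real (st s') \<cdot>\<^sub>v w) (of_real (st s') \<cdot>\<^sub>v w) = 0"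
        by (metis vinner_zero_left)
      then have "st s' = 0" using yw(4) by (simp add: vinner_smult_left vinner_smult_right)
      moreover have "(infp s')\<^sup>2 \<le> \<beta>\<^sup>2"
        using B_le[OF yw(1)] yw(2,4)
        by (simp add: By vinner_smult_left vinner_smult_right power2_eq_square)
      then have "infp s' \<le> \<beta>" using b by (rule power2_le_imp_le)
      ultimately show ?thesis by (auto simp: less_eq_dual_def less_dual_def dual_eq_iff)
    qed
    moreover have "0 \<le> Dual 0 \<beta>" using b by (auto simp: less_eq_dual_def less_dual_def dual_eq_iff)
    ultimately show ?thesis by blast
  next
    case False
    with s have spos: "\<sigma> > 0" by simp
    define H where "H = adj A * A"
    define G where "G = adj A * B"
    define M where "M = H - mat n n (\<lambda>(i, j). if i = j then of_real (\<sigma>\<^sup>2) else 0)"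
    have H: "H \<in> carrier_mat n n" using A by (simp add: H_def)
    have G: "G \<in> carrier_mat n n" using A B by (simp add: G_def)
    have M: "M \<in> carrier_mat n n" by (simp add: M_def minus_carrier_mat)
    have "adj G = adj B * adj (adj A)"
      unfolding G_def using A B by (intro adj_mult) auto
    then have adjG: "adj G = G" by (simp add: G_def AB)
    have ker: "M *\<^sub>v y = 0\<^sub>v n \<longleftrightarrow> H *\<^sub>v y = of_real (\<sigma>\<^sup>2) \<cdot>\<^sub>v y" if y: "y \<in> carrier_vec n" for y
    proof -
      have "mat n n (\<lambda>(i, j). if i = j then of_real (\<sigma>\<^sup>2) else 0) *\<^sub>v y = of_real (\<sigma>\<^sup>2) \<cdot>\<^sub>v y"
        using y by (intro eq_vecI) (auto simp: scalar_prod_def if_distrib[of "\<lambda>c. c * _"] cong: if_cong)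
      then have "M *\<^sub>v y = H *\<^sub>v y - of_real (\<sigma>\<^sup>2) \<cdot>\<^sub>v y"
        unfolding M_def using H y by (subst minus_mult_distrib_mat_vec[of _ n n]) auto
      then show ?thesis using H y by (auto simp: vec_eq_iff)
    qed
    \<comment> \<open>Both conditions are used once:
      \<open>A\<^sup>* A A\<^sup>* B = A\<^sup>* A B\<^sup>* A = A\<^sup>* B A\<^sup>* A\<close>.\<close>
    have HG: "H * G = G * H"
    proof -
      have "H * G = adj A * (A * (adj A * B))"
        unfolding H_def G_def using A B by (intro assoc_mult_mat[of _ n m _ n _ n]) auto
      also have "A * (adj A * B) = A * (adj B * A)" by (simp only: AB)
      also have "\<dots> = (A * adj B) * A"
        using A B by (intro assoc_mult_mat[symmetric, of _ m n _ m _ n]) auto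
      also have "\<dots> = (B * adj A) * A" by (simp only: AB')
      also have "\<dots> = B * H"
        unfolding H_def using A B by (intro assoc_mult_mat[of _ m n _ m _ n]) auto
      also have "adj A * (B * H) = G * H"
        unfolding G_def using A B H by (intro assoc_mult_mat[symmetric, of _ n m _ n _ n]) auto
      finally show ?thesis .
    qed
    have inv: "M *\<^sub>v (G *\<^sub>v y) = 0\<^sub>v n" if y: "y \<in> carrier_vec n" and My: "M *\<^sub>v y = 0\<^sub>v n" for y
    proof -
      have "H *\<^sub>v (G *\<^sub>v y) = (H * G) *\<^sub>v y"
        using H G y by (intro assoc_mult_mat_vec[symmetric]) auto
      also have "\<dots> = G *\<^sub>v (H *\<^sub>v y)"
        unfolding HG using H G y by (intro assoc_mult_mat_vec) auto
      also have "\<dots> = of_real (\<sigma>\<^sup>2) \<cdot>\<^sub>v (G *\<^sub>v y)"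
        using My y by (simp only: ker mult_mat_vec_of_real[OF G])
      finally show ?thesis using ker[of "G *\<^sub>v y"] G y by simp
    qed
    have "H *\<^sub>v x1 = adj A *\<^sub>v (A *\<^sub>v x1)"
      unfolding H_def using A x1 by (intro assoc_mult_mat_vec) auto
    also have "\<dots> = of_real \<sigma> \<cdot>\<^sub>v (adj A *\<^sub>v u1)"
      unfolding Ax1 using A u1 by (intro mult_mat_vec_of_real) auto
    also have "\<dots> = of_real (\<sigma>\<^sup>2) \<cdot>\<^sub>v x1"
      by (simp add: Au1 smult_smult_assoc power2_eq_square)
    finally have "M *\<^sub>v x1 = 0\<^sub>v n" using ker[OF x1(1)] by simp
    then obtain x \<mu> where x: "x \<in> carrier_vec n" "vinner x x = 1" and Mx: "M *\<^sub>v x = 0\<^sub>v n"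
      and Gx: "G *\<^sub>v x = of_real \<mu> \<cdot>\<^sub>v x"
      and max: "\<And>y. y \<in> carrier_vec n \<Longrightarrow> M *\<^sub>v y = 0\<^sub>v n \<Longrightarrow> vinner y (G *\<^sub>v y) \<le> \<mu> * vinner y y"
      using top_eigenvector[OF G adjG M inv x1(1) _ x1(2)] by metis
    have Hx: "H *\<^sub>v x = of_real (\<sigma>\<^sup>2) \<cdot>\<^sub>v x" using Mx ker[OF x(1)] by simp
    define u where "u = of_real (1 / \<sigma>) \<cdot>\<^sub>v (A *\<^sub>v x)"
    define \<beta> where "\<beta> = \<mu> / \<sigma>"
    have u: "u \<in> carrier_vec m" using A x by (simp add: u_def)
    have Ax: "A *\<^sub>v x = of_real \<sigma> \<cdot>\<^sub>v u"
      using False by (simp add: u_def smult_smult_assoc flip: of_real_mult)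
    have Hx': "H *\<^sub>v x = adj A *\<^sub>v (A *\<^sub>v x)"
      unfolding H_def using A x by (intro assoc_mult_mat_vec) auto
    have "adj A *\<^sub>v u = of_real (1 / \<sigma>) \<cdot>\<^sub>v (adj A *\<^sub>v (A *\<^sub>v x))"
      unfolding u_def using A x by (intro mult_mat_vec_of_real) auto
    also have "\<dots> = of_real \<sigma> \<cdot>\<^sub>v x"
      using False
      by (simp only: Hx'[symmetric] Hx smult_smult_assoc flip: of_real_mult) (simp add: power2_eq_square)
    finally have Au: "adj A *\<^sub>v u = of_real \<sigma> \<cdot>\<^sub>v x" .
    have "adj B *\<^sub>v u = of_real (1 / \<sigma>) \<cdot>\<^sub>v (adj B *\<^sub>v (A *\<^sub>v x))"
      unfolding u_def using A B x by (intro mult_mat_vec_of_real) auto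
    also have "adj B *\<^sub>v (A *\<^sub>v x) = (adj B * A) *\<^sub>v x"
      using A B x by (intro assoc_mult_mat_vec[symmetric]) auto
    also have "\<dots> = of_real \<mu> \<cdot>\<^sub>v x" using Gx by (simp add: G_def AB)
    finally have Bu: "adj B *\<^sub>v u = of_real \<beta> \<cdot>\<^sub>v x"
      by (simp only: smult_smult_assoc \<beta>_def flip: of_real_mult) simp
    have uu: "vinner u u = 1"
    proof -
      have "vinner (A *\<^sub>v x) (A *\<^sub>v x) = \<sigma>\<^sup>2"
        using vinner_gram[OF A A x(1)] Hx x by (simp only: H_def[symmetric] vinner_smult_right)
      then show ?thesis
        using False by (simp add: u_def vinner_smult_left vinner_smult_right power2_eq_square)
    qed
    have Bx: "B *\<^sub>v x = of_real \<beta> \<cdot>\<^sub>v u"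
    proof (rule smult_cancel_quat)
      \<comment> \<open>\<open>B A\<^sup>* A = A B\<^sup>* A = A G\<close>, so the eigenvector equations
        of \<open>H\<close> and \<open>G\<close> determine \<open>B x\<close>.\<close>
      have "of_real (\<sigma>\<^sup>2) \<cdot>\<^sub>v (B *\<^sub>v x) = B *\<^sub>v (H *\<^sub>v x)"
        by (simp only: Hx mult_mat_vec_of_real[OF B x(1)])
      also have "\<dots> = (B * H) *\<^sub>v x"
        using B H x by (intro assoc_mult_mat_vec[symmetric]) auto
      also have "B * H = (B * adj A) * A"
        unfolding H_def using A B by (intro assoc_mult_mat[symmetric, of _ m n _ m _ n]) auto
      also have "\<dots> = (A * adj B) * A" by (simp only: AB')
      also have "\<dots> = A * (adj B * A)"
        using A B by (intro assoc_mult_mat[of _ m n _ m _ n]) auto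
      also have "adj B * A = G" by (simp only: G_def AB)
      also have "(A * G) *\<^sub>v x = A *\<^sub>v (G *\<^sub>v x)"
        using A G x by (intro assoc_mult_mat_vec) auto
      also have "\<dots> = of_real \<mu> \<cdot>\<^sub>v (of_real \<sigma> \<cdot>\<^sub>v u)"
        by (simp only: Gx mult_mat_vec_of_real[OF A x(1)] Ax)
      also have "\<dots> = of_real (\<sigma>\<^sup>2) \<cdot>\<^sub>v (of_real \<beta> \<cdot>\<^sub>v u)"
      proof -
        have "\<mu> * \<sigma> = \<sigma>\<^sup>2 * \<beta>" using False by (simp add: \<beta>_def power2_eq_square)
        then show ?thesis by (simp only: smult_smult_assoc flip: of_real_mult)
      qed
      finally show "of_real (\<sigma>\<^sup>2) \<cdot>\<^sub>v (B *\<^sub>v x) = of_real (\<sigma>\<^sup>2) \<cdot>\<^sub>v (of_real \<beta> \<cdot>\<^sub>v u)" .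
    qed (use False in simp)
    have "common_singular A B (Dual \<sigma> \<beta>) x u"
      using A x u uu Ax Au Bx Bu by (simp add: common_singular_def)
    moreover have "s' \<le> Dual \<sigma> \<beta>" if s': "0 \<le> s'" "common_singular A B s' y w" for s' y w
    proof -
      have yw: "y \<in> carrier_vec n" "vinner y y = 1" "w \<in> carrier_vec m" "vinner w w = 1"
        and Ay: "A *\<^sub>v y = of_real (st s') \<cdot>\<^sub>v w" and By: "B *\<^sub>v y = of_real (infp s') \<cdot>\<^sub>v w"
        and Aw: "adj A *\<^sub>v w = of_real (st s') \<cdot>\<^sub>v y"
        using s'(2) A by (auto simp: common_singular_def)
      have "(st s')\<^sup>2 \<le> \<sigma>\<^sup>2"
        using A_le[OF yw(1)] yw(2,4)
        by (simp add: Ay vinner_smult_left vinner_smult_right power2_eq_square)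
      then have le: "st s' \<le> \<sigma>" using s by (rule power2_le_imp_le)
      moreover have "infp s' \<le> \<beta>" if eq: "st s' = \<sigma>"
      proof -
        have "H *\<^sub>v y = adj A *\<^sub>v (A *\<^sub>v y)"
          unfolding H_def using A yw by (intro assoc_mult_mat_vec) auto
        also have "\<dots> = of_real \<sigma> \<cdot>\<^sub>v (adj A *\<^sub>v w)"
          unfolding Ay eq using A yw by (intro mult_mat_vec_of_real) auto
        also have "\<dots> = of_real (\<sigma>\<^sup>2) \<cdot>\<^sub>v y"
          by (simp add: Aw eq smult_smult_assoc power2_eq_square)
        finally have "M *\<^sub>v y = 0\<^sub>v n" using ker[OF yw(1)] by simp
        from max[OF yw(1) this] have "vinner (A *\<^sub>v y) (B *\<^sub>v y) \<le> \<mu>"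
          using vinner_gram[OF A B yw(1)] yw(2) by (simp add: G_def)
        then have "\<sigma> * infp s' \<le> \<mu>"
          using yw(4) by (simp add: Ay By eq vinner_smult_left vinner_smult_right)
        then show ?thesis using spos by (simp add: \<beta>_def field_simps)
      qed
      ultimately show ?thesis by (auto simp: less_eq_dual_def less_dual_def dual_eq_iff)
    qed
    moreover have "0 \<le> Dual \<sigma> \<beta>" using spos by (auto simp: less_eq_dual_def less_dual_def)
    ultimately show ?thesis by blast
  qed
qed

section \<open>Simultaneous singular value decomposition of two quaternion matrices\<close>

definition ordered_diagonal :: "nat \<Rightarrow> nat \<Rightarrow> 'a::{zero, linorder} mat \<Rightarrow> bool" where
  "ordered_diagonal m n S \<longleftrightarrow>
     S \<in> carrier_mat m n \<and> diagonal_mat S \<and> (\<forall>i < min m n. 0 \<le> S $$ (i, i)) \<and>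
     (\<forall>i j. i \<le> j \<longrightarrow> j < min m n \<longrightarrow> S $$ (j, j) \<le> S $$ (i, i))"

definition change_bases :: "'a::star_ring mat \<Rightarrow> 'a mat \<Rightarrow> 'a mat \<Rightarrow> 'a mat" where
  "change_bases U V A = adj U * A * V"

lemma change_bases_carrier:
  "U \<in> carrier_mat m m \<Longrightarrow> V \<in> carrier_mat n n \<Longrightarrow> A \<in> carrier_mat m n \<Longrightarrow>
    change_bases U V A \<in> carrier_mat m n"
  by (auto simp: change_bases_def intro!: mult_carrier_mat)

lemma adj_change_bases:
  assumes U: "U \<in> carrier_mat m m" and V: "V \<in> carrier_mat n n" and A: "A \<in> carrier_mat m n"
  shows "adj (change_bases U V A) = change_bases V U (adj A)"
proof -
  have "adj (change_bases U V A) = adj V * adj (adj U * A)"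
    unfolding change_bases_def using U V A by (intro adj_mult[of _ m n _ n]) auto
  also have "adj (adj U * A) = adj A * U"
    using U A by (subst adj_mult[of _ m m _ n]) auto
  also have "adj V * (adj A * U) = change_bases V U (adj A)"
    unfolding change_bases_def
    using U V A by (intro assoc_mult_mat[symmetric, of _ n n _ m _ m]) auto
  finally show ?thesis .
qed

lemma change_bases_mult:
  assumes U: "U \<in> carrier_mat l l" and V: "unitary m V" and W: "W \<in> carrier_mat n n"
    and X: "X \<in> carrier_mat l m" and Y: "Y \<in> carrier_mat m n"
  shows "change_bases U V X * change_bases V W Y = change_bases U W (X * Y)"
proof -
  note VD = unitaryD[OF V]
  have YW: "Y * W \<in> carrier_mat m n" using Y W by simp
  have "change_bases V W Y = adj V * (Y * W)"
    unfolding change_bases_def using VD W Y by (intro assoc_mult_mat[of _ m m _ n _ n]) auto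
  then have "change_bases U V X * change_bases V W Y = ((adj U * X) * V) * (adj V * (Y * W))"
    by (simp only: change_bases_def[of U V X])
  also have "\<dots> = (adj U * X) * (V * (adj V * (Y * W)))"
    using U VD X YW by (intro assoc_mult_mat[of _ l m _ m _ n]) auto
  also have "V * (adj V * (Y * W)) = (V * adj V) * (Y * W)"
    using VD YW by (intro assoc_mult_mat[symmetric, of _ m m _ m _ n]) auto
  also have "\<dots> = Y * W" by (simp only: VD(4) left_mult_one_mat[OF YW])
  also have "(adj U * X) * (Y * W) = ((adj U * X) * Y) * W"
    using U X Y W by (intro assoc_mult_mat[symmetric, of _ l m _ n _ n]) auto
  also have "(adj U * X) * Y = adj U * (X * Y)"
    using U X Y by (intro assoc_mult_mat[of _ l l _ m _ n]) auto
  finally show ?thesis by (simp add: change_bases_def)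
qed

lemma change_bases_comp:
  assumes U: "U \<in> carrier_mat m m" "U' \<in> carrier_mat m m"
    and V: "V \<in> carrier_mat n n" "V' \<in> carrier_mat n n" and A: "A \<in> carrier_mat m n"
  shows "change_bases U' V' (change_bases U V A) = change_bases (U * U') (V * V') A"
proof -
  have UA: "adj U * A \<in> carrier_mat m n" using U A by (auto intro!: mult_carrier_mat)
  have "adj U' * (adj U * A * V) = (adj U' * (adj U * A)) * V"
    using U V UA by (intro assoc_mult_mat[symmetric, of _ m m _ n _ n]) auto
  also have "adj U' * (adj U * A) = (adj U' * adj U) * A"
    using U A by (intro assoc_mult_mat[symmetric, of _ m m _ m _ n]) auto
  also have "adj U' * adj U = adj (U * U')"
    using U by (intro adj_mult[symmetric, of _ m m _ m]) auto
  finally have "change_bases U' V' (change_bases U V A) = ((adj (U * U') * A) * V) * V'"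
    by (simp add: change_bases_def)
  also have "\<dots> = (adj (U * U') * A) * (V * V')"
    using U V A by (intro assoc_mult_mat[of _ m n _ n _ n] mult_carrier_mat[of _ m m]) auto
  finally show ?thesis by (simp add: change_bases_def)
qed

lemma change_bases_inverse:
  assumes U: "unitary m U" and V: "unitary n V" and A: "A \<in> carrier_mat m n"
  shows "U * change_bases U V A * adj V = A"
proof -
  note UD = unitaryD[OF U] and VD = unitaryD[OF V]
  have "U * change_bases U V A * adj V = change_bases (U * adj U) (V * adj V) A"
    using change_bases_comp[OF UD(1,2) VD(1,2) A] by (simp add: change_bases_def)
  then show ?thesis using UD VD A by (simp add: change_bases_def)
qed

lemma deflate_first_column:
  fixes A :: "quat mat"
  assumes A: "A \<in> carrier_mat (Suc m) (Suc n)" and U: "unitary (Suc m) U" and V: "unitary (Suc n) V"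
    and Ax: "A *\<^sub>v col V 0 = of_real a \<cdot>\<^sub>v col U 0" and i: "i < Suc m"
  shows "change_bases U V A $$ (i, 0) = (if i = 0 then of_real a else 0)"
proof -
  note UD = unitaryD[OF U] and VD = unitaryD[OF V]
  have c: "col V 0 \<in> carrier_vec (Suc n)" "col U 0 \<in> carrier_vec (Suc m)"
    using UD VD by (auto intro!: col_carrier_vec)
  have UA: "adj U * A \<in> carrier_mat (Suc m) (Suc n)" using UD A by (auto intro!: mult_carrier_mat)
  have "col (change_bases U V A) 0 = (adj U * A) *\<^sub>v col V 0"
    unfolding change_bases_def using UA VD by (intro col_mult2) auto
  also have "\<dots> = adj U *\<^sub>v (A *\<^sub>v col V 0)"
    using UD A c by (intro assoc_mult_mat_vec) auto
  also have "\<dots> = of_real a \<cdot>\<^sub>v (adj U *\<^sub>v col U 0)"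
    unfolding Ax using UD c by (intro mult_mat_vec_of_real) auto
  also have "adj U *\<^sub>v col U 0 = col (adj U * U) 0"
    using UD by (intro col_mult2[symmetric]) auto
  also have "\<dots> = unit_vec (Suc m) 0" using UD by simp
  finally have "col (change_bases U V A) 0 $ i = (of_real a \<cdot>\<^sub>v unit_vec (Suc m) 0) $ i" by simp
  then show ?thesis
    using i change_bases_carrier[OF UD(1) VD(1) A] by (auto simp: unit_vec_def split: if_splits)
qed

text \<open>For singular vectors of \<open>A\<close> as first columns of the bases, the first column of \<open>A\<close> is controlled by
the equation for \<open>A\<close> and the first row by the equation for the adjoint.\<close>
lemma deflate:
  fixes A :: "quat mat"
  assumes A: "A \<in> carrier_mat (Suc m) (Suc n)" and U: "unitary (Suc m) U" and V: "unitary (Suc n) V"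
    and Ax: "A *\<^sub>v col V 0 = of_real a \<cdot>\<^sub>v col U 0" and Au: "adj A *\<^sub>v col U 0 = of_real a \<cdot>\<^sub>v col V 0"
  shows "\<exists>A'\<in>carrier_mat m n. change_bases U V A = corner (of_real a) m n A'"
proof
  note UD = unitaryD[OF U] and VD = unitaryD[OF V]
  define P where "P = change_bases U V A"
  have P: "P \<in> carrier_mat (Suc m) (Suc n)"
    unfolding P_def by (rule change_bases_carrier[OF UD(1) VD(1) A])
  have left: "P $$ (i, 0) = (if i = 0 then of_real a else 0)" if "i < Suc m" for i
    unfolding P_def by (rule deflate_first_column[OF A U V Ax that])
  have "adj P $$ (j, 0) = (if j = 0 then of_real a else 0)" if "j < Suc n" for j
    unfolding P_def adj_change_bases[OF UD(1) VD(1) A]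
    using A by (intro deflate_first_column[OF _ V U Au that]) simp
  then have "conjugate (P $$ (0, j)) = (if j = 0 then of_real a else 0)" if "j < Suc n" for j
    using that P by simp
  then have top: "P $$ (0, j) = (if j = 0 then of_real a else 0)" if "j < Suc n" for j
    using that by (metis conjugate_id conjugate_of_real star_zero)
  show "change_bases U V A = corner (of_real a) m n (mat m n (\<lambda>(i, j). P $$ (Suc i, Suc j)))"
    unfolding P_def[symmetric] using P left top by (intro eq_matI) auto
qed simp

lemma corner_inject:
  assumes "corner a m n A = corner b m n B" "A \<in> carrier_mat m n" "B \<in> carrier_mat m n"
  shows "A = B"
proof (rule eq_matI)
  fix i j assume "i < dim_row B" "j < dim_col B"
  then have "corner a m n A $$ (Suc i, Suc j) = A $$ (i, j)" "corner b m n B $$ (Suc i, Suc j) = B $$ (i, j)"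
    using assms(2,3) by auto
  with assms(1) show "A $$ (i, j) = B $$ (i, j)" by simp
qed (use assms(2,3) in auto)

lemma singular_column:
  fixes A :: "quat mat"
  assumes A: "A \<in> carrier_mat m n" and U: "unitary m U" and V: "unitary n V"
    and D: "change_bases U V A = map_mat f S" and S: "S \<in> carrier_mat m n" "diagonal_mat S"
    and f: "f 0 = 0" "f (S $$ (i, i)) = of_real r" and i: "i < m" "i < n"
  shows "A *\<^sub>v col V i = of_real r \<cdot>\<^sub>v col U i"
proof -
  note UD = unitaryD[OF U] and VD = unitaryD[OF V]
  have AV: "A * V \<in> carrier_mat m n" using A VD by simp
  have "U * change_bases U V A = U * (adj U * (A * V))"
    unfolding change_bases_def using UD VD A by (subst assoc_mult_mat[of _ m m _ n _ n]) auto
  also have "\<dots> = (U * adj U) * (A * V)"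
    using UD AV by (intro assoc_mult_mat[symmetric, of _ m m _ m _ n]) auto
  also have "\<dots> = A * V" by (simp only: UD(4) left_mult_one_mat[OF AV])
  finally have AV_eq: "A * V = U * map_mat f S" by (simp add: D)
  have "A *\<^sub>v col V i = col (A * V) i"
    by (rule col_mult2[OF A VD(1) i(2), symmetric])
  also have "\<dots> = U *\<^sub>v col (map_mat f S) i"
    unfolding AV_eq using S by (intro col_mult2[OF UD(1) _ i(2)]) auto
  also have "col (map_mat f S) i = of_real r \<cdot>\<^sub>v unit_vec m i"
    using S i f by (intro eq_vecI) (auto simp: diagonal_mat_def unit_vec_def)
  also have "U *\<^sub>v (of_real r \<cdot>\<^sub>v unit_vec m i) = of_real r \<cdot>\<^sub>v (U *\<^sub>v unit_vec m i)"
    using UD by (intro mult_mat_vec_of_real) auto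
  also have "U *\<^sub>v unit_vec m i = col U i"
    using UD i by (intro eq_vecI) (auto simp: scalar_prod_right_unit)
  finally show ?thesis .
qed

text \<open>The standard and the infinitesimal parts of the dual matrix \<open>S\<close> hold the diagonal forms of
\<open>A\<close> and of \<open>B\<close>. No order is imposed here, since the columns of such a decomposition
are used as common singular vectors before the order of the diagonal is known.\<close>
definition joint_svd ::
  "quat mat \<Rightarrow> quat mat \<Rightarrow> quat mat \<Rightarrow> dual_real mat \<Rightarrow> quat mat \<Rightarrow> bool" where
  "joint_svd A B U S V \<longleftrightarrow> unitary (dim_row A) U \<and> unitary (dim_col A) V \<and>
     change_bases U V A = map_mat (\<lambda>d. of_real (st d)) S \<and>
     change_bases U V B = map_mat (\<lambda>d. of_real (infp d)) S"

lemma unitary_column_unit: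
  assumes "unitary n (U::quat mat)" "i < n"
  shows "vinner (col U i) (col U i) = 1"
proof -
  have "U *\<^sub>v unit_vec n i = col U i"
    using unitaryD[OF assms(1)] assms(2) by (intro eq_vecI) (auto simp: scalar_prod_right_unit)
  then show ?thesis
    using unitary_vinner[OF assms(1), of "unit_vec n i" "unit_vec n i"] assms(2) by simp
qed

lemma joint_svd_common_singular:
  assumes A: "A \<in> carrier_mat m n" and B: "B \<in> carrier_mat m n"
    and J: "joint_svd A B U S V" and S: "S \<in> carrier_mat m n" "diagonal_mat S"
    and i: "i < m" "i < n"
  shows "common_singular A B (S $$ (i, i)) (col V i) (col U i)"
proof -
  have U: "unitary m U" and V: "unitary n V"
    and DA: "change_bases U V A = map_mat (\<lambda>d. of_real (st d)) S"
    and DB: "change_bases U V B = map_mat (\<lambda>d. of_real (infp d)) S"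
    using J A by (auto simp: joint_svd_def)
  note UD = unitaryD[OF U] and VD = unitaryD[OF V]
  let ?T = "mat n m (\<lambda>(i, j). S $$ (j, i))"
  have T: "?T \<in> carrier_mat n m" "diagonal_mat ?T" using S by (auto simp: diagonal_mat_def)
  have DA': "change_bases V U (adj A) = map_mat (\<lambda>d. of_real (st d)) ?T"
    unfolding adj_change_bases[OF UD(1) VD(1) A, symmetric] DA using S by (intro eq_matI) auto
  have DB': "change_bases V U (adj B) = map_mat (\<lambda>d. of_real (infp d)) ?T"
    unfolding adj_change_bases[OF UD(1) VD(1) B, symmetric] DB using S by (intro eq_matI) auto
  have "A *\<^sub>v col V i = of_real (st (S $$ (i, i))) \<cdot>\<^sub>v col U i"
    "B *\<^sub>v col V i = of_real (infp (S $$ (i, i))) \<cdot>\<^sub>v col U i"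
    using singular_column[OF A U V DA S _ _ i] singular_column[OF B U V DB S _ _ i] by simp_all
  moreover have "adj A *\<^sub>v col U i = of_real (st (S $$ (i, i))) \<cdot>\<^sub>v col V i"
    "adj B *\<^sub>v col U i = of_real (infp (S $$ (i, i))) \<cdot>\<^sub>v col V i"
    using singular_column[OF _ V U DA' T _ _ i(2,1)] singular_column[OF _ V U DB' T _ _ i(2,1)] A B i
    by simp_all
  ultimately show ?thesis
    using A UD VD i unitary_column_unit[OF U] unitary_column_unit[OF V]
    by (auto simp: common_singular_def)
qed

text \<open>Induction by deflation: split off the largest common singular pair, note that the Hermitian conditions
survive the change of bases and pass to the remaining blocks, and decompose these. The diagonal comes out
in decreasing dual order because each later entry is itself the value of a common singular pair of
the original matrices, hence at most the value that was split off.\<close>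
lemma joint_svd_exists:
  fixes A B :: "quat mat"
  assumes "A \<in> carrier_mat m n" "B \<in> carrier_mat m n"
    and "adj A * B = adj B * A" "A * adj B = B * adj A"
  shows "\<exists>U S V. ordered_diagonal m n S \<and> joint_svd A B U S V"
  using assms
proof (induction m arbitrary: n A B)
  case 0
  then show ?case
    by (intro exI[of _ "1\<^sub>m 0"] exI[of _ "0\<^sub>m 0 n"] exI[of _ "1\<^sub>m n"])
      (auto simp: ordered_diagonal_def joint_svd_def change_bases_def diagonal_mat_def)
next
  case (Suc m n' A B)
  show ?case
  proof (cases n')
    case 0
    with Suc show ?thesis
      by (intro exI[of _ "1\<^sub>m (Suc m)"] exI[of _ "0\<^sub>m (Suc m) 0"] exI[of _ "1\<^sub>m 0"])
        (auto simp: ordered_diagonal_def joint_svd_def change_bases_def diagonal_mat_def)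
  next
    case (Suc n)
    note A = Suc.prems(1)[unfolded Suc] and B = Suc.prems(2)[unfolded Suc]
    obtain s x u where s: "0 \<le> s" and xu: "common_singular A B s x u"
      and max: "\<And>s' y w. 0 \<le> s' \<Longrightarrow> common_singular A B s' y w \<Longrightarrow> s' \<le> s"
      using top_common_singular[OF A B _ _ Suc.prems(3,4)] by blast
    have x: "x \<in> carrier_vec (Suc n)" "vinner x x = 1" and u: "u \<in> carrier_vec (Suc m)" "vinner u u = 1"
      using xu A by (auto simp: common_singular_def)
    obtain V1 where V1: "unitary (Suc n) V1" "col V1 0 = x"
      using unit_vector_is_first_column[OF x(1) _ x(2)] by auto
    obtain U1 where U1: "unitary (Suc m) U1" "col U1 0 = u"
      using unit_vector_is_first_column[OF u(1) _ u(2)] by auto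
    note U1D = unitaryD[OF U1(1)] and V1D = unitaryD[OF V1(1)]
    obtain A' where A': "A' \<in> carrier_mat m n" "change_bases U1 V1 A = corner (of_real (st s)) m n A'"
      using deflate[OF A U1(1) V1(1)] xu by (auto simp: common_singular_def U1 V1)
    obtain B' where B': "B' \<in> carrier_mat m n" "change_bases U1 V1 B = corner (of_real (infp s)) m n B'"
      using deflate[OF B U1(1) V1(1)] xu by (auto simp: common_singular_def U1 V1)
    have adjA: "change_bases V1 U1 (adj A) = corner (of_real (st s)) n m (adj A')"
      using adj_change_bases[OF U1D(1) V1D(1) A] by (simp only: A' adj_corner[OF A'(1)] conjugate_of_real)
    have adjB: "change_bases V1 U1 (adj B) = corner (of_real (infp s)) n m (adj B')"
      using adj_change_bases[OF U1D(1) V1D(1) B] by (simp only: B' adj_corner[OF B'(1)] conjugate_of_real)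
    have carr: "adj A \<in> carrier_mat (Suc n) (Suc m)" "adj B \<in> carrier_mat (Suc n) (Suc m)"
      "adj A' \<in> carrier_mat n m" "adj B' \<in> carrier_mat n m"
      using A B A' B' by simp_all
    have "adj A' * B' = adj B' * A'"
    proof (rule corner_inject)
      have "corner (of_real (st s)) n m (adj A') * corner (of_real (infp s)) m n B'
          = change_bases V1 V1 (adj A * B)"
        using change_bases_mult[OF V1D(1) U1(1) V1D(1) carr(1) B] by (simp only: adjA B')
      also have "\<dots> = change_bases V1 V1 (adj B * A)" using Suc.prems(3) by simp
      also have "\<dots> = corner (of_real (infp s)) n m (adj B') * corner (of_real (st s)) m n A'"
        using change_bases_mult[OF V1D(1) U1(1) V1D(1) carr(2) A] by (simp only: adjB A')
      finally show "corner (of_real (st s) * of_real (infp s)) n n (adj A' * B')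
          = corner (of_real (infp s) * of_real (st s)) n n (adj B' * A')"
        by (simp only: corner_mult[OF carr(3) B'(1)] corner_mult[OF carr(4) A'(1)])
    qed (use carr A' B' in auto)
    moreover have "A' * adj B' = B' * adj A'"
    proof (rule corner_inject)
      have "corner (of_real (st s)) m n A' * corner (of_real (infp s)) n m (adj B')
          = change_bases U1 U1 (A * adj B)"
        using change_bases_mult[OF U1D(1) V1(1) U1D(1) A carr(2)] by (simp only: adjB A')
      also have "\<dots> = change_bases U1 U1 (B * adj A)" using Suc.prems(4) by simp
      also have "\<dots> = corner (of_real (infp s)) m n B' * corner (of_real (st s)) n m (adj A')"
        using change_bases_mult[OF U1D(1) V1(1) U1D(1) B carr(1)] by (simp only: adjA B')
      finally show "corner (of_real (st s) * of_real (infp s)) m m (A' * adj B')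
          = corner (of_real (infp s) * of_real (st s)) m m (B' * adj A')"
        by (simp only: corner_mult[OF A'(1) carr(4)] corner_mult[OF B'(1) carr(3)])
    qed (use carr A' B' in auto)
    ultimately obtain U2 S2 V2 where S2: "ordered_diagonal m n S2" and J2: "joint_svd A' B' U2 S2 V2"
      using Suc.IH[OF A'(1) B'(1)] by blast
    have S2C: "S2 \<in> carrier_mat m n" using S2 by (simp add: ordered_diagonal_def)
    have U2: "unitary m U2" and V2: "unitary n V2"
      and eq2: "change_bases U2 V2 A' = map_mat (\<lambda>d. of_real (st d)) S2"
        "change_bases U2 V2 B' = map_mat (\<lambda>d. of_real (infp d)) S2"
      using J2 A' by (auto simp: joint_svd_def)
    note U2D = unitaryD[OF U2] and V2D = unitaryD[OF V2]
    define W where "W = corner 1 m m U2"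
    define Z where "Z = corner 1 n n V2"
    have W: "unitary (Suc m) W" and Z: "unitary (Suc n) Z"
      unfolding W_def Z_def using unitary_corner[OF U2, of 1] unitary_corner[OF V2, of 1] by simp_all
    note WD = unitaryD[OF W] and ZD = unitaryD[OF Z]
    have corner_change: "change_bases W Z (corner c m n X) = corner c m n (change_bases U2 V2 X)"
      if X: "X \<in> carrier_mat m n" for c and X :: "quat mat"
    proof -
      have UX: "adj U2 * X \<in> carrier_mat m n" using U2D X by simp
      show ?thesis
        by (simp only: change_bases_def W_def Z_def adj_corner[OF U2D(1)] star_one mult_1_left mult_1_right
            corner_mult[OF U2D(2) X] corner_mult[OF UX V2D(1)])
    qed
    define S where "S = corner s m n S2"
    have SC: "S \<in> carrier_mat (Suc m) (Suc n)"
      unfolding S_def using four_block_carrier_mat[OF _ S2C, of "mat 1 1 (\<lambda>_. s)" 1 1] by simp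
    have S00: "S $$ (0, 0) = s" using S2C by (simp add: S_def)
    have SSS: "S $$ (Suc i, Suc i) = S2 $$ (i, i)" if "i < min m n" for i
      using S2C that by (simp add: S_def)
    have diag: "diagonal_mat S"
      using S2 by (auto simp: S_def ordered_diagonal_def diagonal_mat_def)
    have joint: "joint_svd A B (U1 * W) S (V1 * Z)"
    proof -
      have "change_bases (U1 * W) (V1 * Z) A = corner (of_real (st s)) m n (change_bases U2 V2 A')"
        using change_bases_comp[OF U1D(1) WD(1) V1D(1) ZD(1) A] by (simp only: A'(2) corner_change[OF A'(1)])
      also have "\<dots> = map_mat (\<lambda>d. of_real (st d)) S"
        unfolding S_def eq2 using S2C by (intro eq_matI) auto
      finally have 1: "change_bases (U1 * W) (V1 * Z) A = map_mat (\<lambda>d. of_real (st d)) S" .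
      have "change_bases (U1 * W) (V1 * Z) B = corner (of_real (infp s)) m n (change_bases U2 V2 B')"
        using change_bases_comp[OF U1D(1) WD(1) V1D(1) ZD(1) B] by (simp only: B'(2) corner_change[OF B'(1)])
      also have "\<dots> = map_mat (\<lambda>d. of_real (infp d)) S"
        unfolding S_def eq2 using S2C by (intro eq_matI) auto
      finally show ?thesis
        using 1 A unitary_mult[OF U1(1) W] unitary_mult[OF V1(1) Z] by (simp add: joint_svd_def)
    qed
    have nonneg: "0 \<le> S $$ (i, i)" if "i < min (Suc m) (Suc n)" for i
      using that s S2 by (cases i) (auto simp: S00 SSS ordered_diagonal_def)
    have "S $$ (j, j) \<le> S $$ (i, i)" if ij: "i \<le> j" "j < min (Suc m) (Suc n)" for i j
    proof (cases i)
      case 0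
      then show ?thesis
        using max[OF nonneg joint_svd_common_singular[OF A B joint SC diag], of j] ij by (simp add: S00)
    next
      case (Suc i')
      then obtain j' where "j = Suc j'" using ij(1) by (cases j) auto
      with Suc ij S2 show ?thesis by (auto simp: SSS ordered_diagonal_def)
    qed
    then have "ordered_diagonal (Suc m) (Suc n) S"
      using SC diag nonneg by (simp add: ordered_diagonal_def)
    with joint show ?thesis unfolding \<open>n' = Suc n\<close> by blast
  qed
qed

section \<open>The singular value decomposition of a dual quaternion matrix\<close>

definition dual_mat :: "'a mat \<Rightarrow> 'a mat \<Rightarrow> 'a dual mat" where
  "dual_mat X Y = mat (dim_row X) (dim_col X) (\<lambda>ij. Dual (X $$ ij) (Y $$ ij))"

lemma dual_mat_dim [simp]: "dim_row (dual_mat X Y) = dim_row X" "dim_col (dual_mat X Y) = dim_col X"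
  by (simp_all add: dual_mat_def)

lemma index_dual_mat [simp]:
  "i < dim_row X \<Longrightarrow> j < dim_col X \<Longrightarrow> dual_mat X Y $$ (i, j) = Dual (X $$ (i, j)) (Y $$ (i, j))"
  by (simp add: dual_mat_def)

lemma dual_mat_carrier: "X \<in> carrier_mat m n \<Longrightarrow> dual_mat X Y \<in> carrier_mat m n"
  unfolding carrier_mat_def by simp

lemma st_sum: "st (sum f I) = (\<Sum>i\<in>I. st (f i :: 'a::ring_1 dual))"
  by (induction I rule: infinite_finite_induct) simp_all

lemma infp_sum: "infp (sum f I) = (\<Sum>i\<in>I. infp (f i :: 'a::ring_1 dual))"
  by (induction I rule: infinite_finite_induct) simp_all

lemma dual_mat_mult:
  fixes X Y :: "'a::ring_1 mat"
  assumes "X \<in> carrier_mat m k" "X' \<in> carrier_mat m k" "Y \<in> carrier_mat k n" "Y' \<in> carrier_mat k n"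
  shows "dual_mat X X' * dual_mat Y Y' = dual_mat (X * Y) (X * Y' + X' * Y)"
  using assms
  by (intro eq_matI) (auto simp: scalar_prod_def dual_eq_iff st_sum infp_sum sum.distrib)

lemma adj_dual_mat:
  fixes X Y :: "'a::star_ring mat"
  assumes "X \<in> carrier_mat m n" "Y \<in> carrier_mat m n"
  shows "adj (dual_mat X Y) = dual_mat (adj X) (adj Y)"
  using assms by (intro eq_matI) (auto simp: conjugate_dual_def)

lemma dual_mat_one: "dual_mat (1\<^sub>m n) (0\<^sub>m n n) = (1\<^sub>m n :: 'a::ring_1 dual mat)"
  by (rule eq_matI) (auto simp: dual_eq_iff)

lemma dual_mat_split: "dual_mat (map_mat st A) (map_mat infp A) = A"
  by (rule eq_matI) auto

lemma unitary_dual_mat: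
  fixes U :: "'a::star_ring mat"
  assumes U: "unitary n U"
  shows "unitary n (dual_mat U (0\<^sub>m n n))"
proof -
  note UD = unitaryD[OF U]
  have z: "0\<^sub>m n n \<in> carrier_mat n n" by simp
  have "0\<^sub>m n n + 0\<^sub>m n n = (0\<^sub>m n n :: 'a mat)" by simp
  then show ?thesis
    using UD by (simp add: unitary_def adj_dual_mat[OF UD(1) z] dual_mat_mult[of _ n n _ _ n] dual_mat_one
        dual_mat_carrier)
qed

text \<open>These are the unitary matrices infinitely close to the identity: \<open>(I + K\<epsilon>)\<^sup>* (I + K\<epsilon>) = I + (K\<^sup>* + K)\<epsilon>\<close>.\<close>
lemma unitary_infinitesimal_rotation:
  fixes K :: "'a::star_ring mat"
  assumes K: "K \<in> carrier_mat n n" and skew: "adj K = - K"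
  shows "unitary n (dual_mat (1\<^sub>m n) K)"
proof -
  have one: "1\<^sub>m n \<in> carrier_mat n n" by simp
  have K': "- K \<in> carrier_mat n n" using K by simp
  have a: "adj (dual_mat (1\<^sub>m n) K) = dual_mat (1\<^sub>m n) (- K)"
    by (simp only: adj_dual_mat[OF one K] skew adj_one)
  have "1\<^sub>m n * K + - K * 1\<^sub>m n = 0\<^sub>m n n" "1\<^sub>m n * - K + K * 1\<^sub>m n = 0\<^sub>m n n"
    using K K' by (intro eq_matI; simp)+
  then show ?thesis
    unfolding unitary_def a dual_mat_mult[OF one K' one K] dual_mat_mult[OF one K one K']
    by (simp add: dual_mat_one dual_mat_carrier)
qed

text \<open>Infinitesimal rotations on both sides change \<open>S + B\<epsilon>\<close> into \<open>S + (B + K S + S L)\<epsilon>\<close>. Entrywise this adds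
\<open>s\<^sub>j k\<^sub>i\<^sub>j + s\<^sub>i l\<^sub>i\<^sub>j\<close> to \<open>b\<^sub>i\<^sub>j\<close>. Where \<open>s\<^sub>i \<noteq> s\<^sub>j\<close>, the equations for the positions \<open>(i, j)\<close> and
\<open>(j, i)\<close> form a linear system with determinant \<open>s\<^sub>i\<^sup>2 - s\<^sub>j\<^sup>2\<close> up to sign, so both entries can be removed;
where \<open>s\<^sub>i = s\<^sub>j > 0\<close>, the skew part can be removed. What is left is Hermitian within the blocks of equal
positive \<open>s\<^sub>i\<close>, arbitrary in the block of zeros and 0 elsewhere, which is precisely the condition for a
simultaneous decomposition of \<open>S\<close> and \<open>C\<close>.\<close>
lemma infinitesimal_rotation_to_hermitian:
  fixes B :: "quat mat" and s :: "nat \<Rightarrow> real"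
  assumes B: "B \<in> carrier_mat m n"
    and s: "\<And>i. 0 \<le> s i" "\<And>i. min m n \<le> i \<Longrightarrow> s i = 0"
    and S_def: "S = mat m n (\<lambda>(i, j). if i = j then of_real (s i) else 0)"
  obtains K L C where "K \<in> carrier_mat m m" "adj K = - K" "L \<in> carrier_mat n n" "adj L = - L"
    "C = B + (K * S + S * L)" "adj S * C = adj C * S" "S * adj C = C * adj S"
proof -
  \<comment> \<open>Entries are continued by 0, so that the formulas below also cover the rows or
    columns beyond the diagonal, where one of \<open>s\<^sub>i\<close>, \<open>s\<^sub>j\<close> is 0.
    For \<open>s\<^sub>i = s\<^sub>j = 0\<close> the default value of the division makes
    \<open>k\<close> vanish.\<close>
  define b where "b i j = (if i < m \<and> j < n then B $$ (i, j) else 0)" for i j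
  define k where "k i j = (if s i = s j then - (1 / (2 * s i)) *\<^sub>R (b i j - conjugate (b j i))
    else (1 / ((s i)\<^sup>2 - (s j)\<^sup>2)) *\<^sub>R (s j *\<^sub>R b i j + s i *\<^sub>R conjugate (b j i)))" for i j
  define l where "l i j = (if s i = s j then 0
    else - (1 / ((s i)\<^sup>2 - (s j)\<^sup>2)) *\<^sub>R (s i *\<^sub>R b i j + s j *\<^sub>R conjugate (b j i)))" for i j
  define c where "c i j = b i j + (s j *\<^sub>R k i j + s i *\<^sub>R l i j)" for i j
  define K where "K = mat m m (\<lambda>(i, j). k i j)"
  define L where "L = mat n n (\<lambda>(i, j). l i j)"
  define C where "C = B + (K * S + S * L)"
  have conj_scaleR: "conjugate (r *\<^sub>R q) = r *\<^sub>R conjugate q" for r and q :: quat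
    by (simp add: quat_eq_iff conjugate_quat_def scaleR_quat_def)
  have minus_swap: "1 / ((s j)\<^sup>2 - (s i)\<^sup>2) = - (1 / ((s i)\<^sup>2 - (s j)\<^sup>2))" for i j
    by (metis minus_diff_eq minus_divide_right)
  have k_skew: "conjugate (k j i) = - k i j" for i j
    unfolding k_def
    by (simp add: conj_scaleR star_add star_minus minus_swap[of i j] add.commute
        flip: scaleR_minus_right)
  have l_skew: "conjugate (l j i) = - l i j" for i j
    unfolding l_def
    by (simp add: conj_scaleR star_add star_minus minus_swap[of i j] add.commute
        flip: scaleR_minus_right)
  have c_diff: "c i j = 0" if ne: "s i \<noteq> s j" for i j
  proof -
    define d where "d = (s i)\<^sup>2 - (s j)\<^sup>2"
    have d: "d \<noteq> 0" using ne s(1) by (simp add: d_def power2_eq_iff_nonneg)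
    have k: "k i j = (1 / d) *\<^sub>R (s j *\<^sub>R b i j + s i *\<^sub>R conjugate (b j i))"
      and l: "l i j = - (1 / d) *\<^sub>R (s i *\<^sub>R b i j + s j *\<^sub>R conjugate (b j i))"
      using ne by (simp_all add: k_def l_def d_def)
    have "s j *\<^sub>R k i j + s i *\<^sub>R l i j = (1 / d) *\<^sub>R (((s j)\<^sup>2 - (s i)\<^sup>2) *\<^sub>R b i j)"
      unfolding k l by (simp add: algebra_simps power2_eq_square)
    also have "\<dots> = ((1 / d) * ((s j)\<^sup>2 - (s i)\<^sup>2)) *\<^sub>R b i j" by simp
    also have "(1 / d) * ((s j)\<^sup>2 - (s i)\<^sup>2) = - 1" using d by (simp add: d_def field_simps)
    also have "- 1 *\<^sub>R b i j = - b i j" by simp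
    finally show ?thesis by (simp add: c_def)
  qed
  have c_eq: "c i j = conjugate (c j i)" if eq: "s i = s j" "s i \<noteq> 0" for i j
  proof -
    have half: "c i j = (1 / 2) *\<^sub>R (b i j + conjugate (b j i))" if "s i = s j" "s i \<noteq> 0" for i j
    proof -
      have "c i j = b i j - (1 / 2) *\<^sub>R (b i j - conjugate (b j i))"
        using that by (simp add: c_def k_def l_def)
      also have "\<dots> = (1 / 2) *\<^sub>R (b i j + conjugate (b j i))"
        by (simp add: quat_eq_iff scaleR_quat_def conjugate_quat_def field_simps)
      finally show ?thesis .
    qed
    show ?thesis
      using half[OF eq] half[of j i] eq by (simp add: conj_scaleR star_add add.commute)
  qed
  have balance: "s i *\<^sub>R c i j = s j *\<^sub>R conjugate (c j i)" for i j
    using c_diff[of i j] c_diff[of j i] c_eq[of i j] by (cases "s i = s j"; cases "s i = 0") auto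
  have balance': "s j *\<^sub>R c i j = s i *\<^sub>R conjugate (c j i)" for i j
    using c_diff[of i j] c_diff[of j i] c_eq[of i j] by (cases "s i = s j"; cases "s i = 0") auto
  have KC: "K \<in> carrier_mat m m" and LC: "L \<in> carrier_mat n n" and SC: "S \<in> carrier_mat m n"
    by (simp_all add: K_def L_def S_def)
  have CC: "C \<in> carrier_mat m n" using B KC LC SC by (simp add: C_def)
  have C_index: "C $$ (i, j) = c i j" if ij: "i < m" "j < n" for i j
  proof -
    have "(K * S) $$ (i, j) = (\<Sum>a<m. k i a * S $$ (a, j))"
      using ij SC by (simp add: K_def scalar_prod_def lessThan_atLeast0)
    also have "\<dots> = (\<Sum>a<m. if a = j then s j *\<^sub>R k i j else 0)"
      using ij by (intro sum.cong) (auto simp: S_def of_real_def)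
    also have "\<dots> = s j *\<^sub>R k i j" using s(2)[of j] by (simp add: not_less)
    finally have 1: "(K * S) $$ (i, j) = s j *\<^sub>R k i j" .
    have "(S * L) $$ (i, j) = (\<Sum>a<n. S $$ (i, a) * l a j)"
      using ij SC by (simp add: L_def scalar_prod_def lessThan_atLeast0)
    also have "\<dots> = (\<Sum>a<n. if a = i then s i *\<^sub>R l i j else 0)"
      using ij by (intro sum.cong) (auto simp: S_def of_real_def)
    also have "\<dots> = s i *\<^sub>R l i j" using s(2)[of i] by (simp add: not_less)
    finally show ?thesis
      using 1 ij B KC LC SC by (simp add: C_def c_def b_def del: index_mult_mat(1))
  qed
  have c_row: "s i *\<^sub>R c i j = (\<Sum>a<m. adj S $$ (i, a) * C $$ (a, j))" if ij: "i < n" "j < n" for i j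
  proof -
    have "(\<Sum>a<m. adj S $$ (i, a) * C $$ (a, j)) = (\<Sum>a<m. if a = i then s i *\<^sub>R c i j else 0)"
      using ij SC by (intro sum.cong) (auto simp: S_def of_real_mult_quat C_index)
    then show ?thesis using s(2)[of i] by (simp add: not_less)
  qed
  have c_col: "s j *\<^sub>R c i j = (\<Sum>a<n. C $$ (i, a) * adj S $$ (a, j))" if ij: "i < m" "j < m" for i j
  proof -
    have "(\<Sum>a<n. C $$ (i, a) * adj S $$ (a, j)) = (\<Sum>a<n. if a = j then s j *\<^sub>R c i j else 0)"
      using ij SC by (intro sum.cong) (auto simp: S_def mult_of_real_quat C_index)
    then show ?thesis using s(2)[of j] by (simp add: not_less)
  qed
  have SC_index: "(adj S * C) $$ (i, j) = s i *\<^sub>R c i j" if "i < n" "j < n" for i j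
    using c_row[OF that] that SC CC by (simp add: scalar_prod_def lessThan_atLeast0)
  have CS_index: "(C * adj S) $$ (i, j) = s j *\<^sub>R c i j" if "i < m" "j < m" for i j
    using c_col[OF that] that SC CC by (simp add: scalar_prod_def lessThan_atLeast0)
  have "adj (adj S * C) = adj S * C"
    using SC CC by (intro eq_matI) (simp_all add: SC_index conj_scaleR balance[symmetric] del: index_mult_mat(1))
  moreover have "adj (adj S * C) = adj C * S"
    using SC CC by (subst adj_mult[of _ n m _ n]) auto
  ultimately have 1: "adj S * C = adj C * S" by simp
  have "adj (C * adj S) = C * adj S"
    using SC CC by (intro eq_matI) (simp_all add: CS_index conj_scaleR balance'[symmetric] del: index_mult_mat(1))
  moreover have "adj (C * adj S) = S * adj C"
    using SC CC by (subst adj_mult[of _ m n _ m]) auto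
  ultimately have 2: "S * adj C = C * adj S" by simp
  have "adj K = - K" "adj L = - L"
    by (intro eq_matI; simp add: K_def L_def k_skew l_skew)+
  then show thesis using that[OF KC _ LC _ C_def 1 2] by blast
qed

lemma dq_svd_iff:
  assumes "A \<in> carrier_mat m n"
  shows "dq_svd A U S V \<longleftrightarrow> unitary m U \<and> unitary n V \<and> ordered_diagonal m n S \<and>
    A = U * map_mat dq_of_dual S * adj V"
  by (simp only: dq_svd_def ordered_diagonal_def dq_unitary_eq_unitary dq_adjoint_eq_adj
      carrier_matD[OF assms] conj_assoc)

text \<open>Three changes of bases: a singular value decomposition of the standard part (the joint decomposition with
a zero second matrix), an infinitesimal rotation that makes the two parts jointly diagonalizable, and their
joint decomposition, whose lexicographic order is the order required of dual singular values.\<close>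
lemma dq_svd_exists:
  fixes A :: "dual_quat mat"
  assumes A: "A \<in> carrier_mat m n"
  shows "\<exists>U S V. dq_svd A U S V"
proof -
  define A0 where "A0 = map_mat st A"
  define A1 where "A1 = map_mat infp A"
  have A01: "A0 \<in> carrier_mat m n" "A1 \<in> carrier_mat m n" using A by (simp_all add: A0_def A1_def)
  have A_eq: "A = dual_mat A0 A1" by (simp add: A0_def A1_def dual_mat_split)
  have Z: "0\<^sub>m m n \<in> carrier_mat m n" by simp
  obtain U1 R V1 where R: "ordered_diagonal m n R" and J1: "joint_svd A0 (0\<^sub>m m n) U1 R V1"
    using joint_svd_exists[OF A01(1) Z] A01 by auto
  have U1: "unitary m U1" and V1: "unitary n V1"
    and D1: "change_bases U1 V1 A0 = map_mat (\<lambda>d. of_real (st d)) R"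
    using J1 A01 by (auto simp: joint_svd_def)
  note U1D = unitaryD[OF U1] and V1D = unitaryD[OF V1]
  define s where "s i = (if i < min m n then st (R $$ (i, i)) else 0)" for i
  define S where "S = mat m n (\<lambda>(i, j). if i = j then of_real (s i) else 0 :: quat)"
  define B where "B = change_bases U1 V1 A1"
  have S_eq: "change_bases U1 V1 A0 = S"
    unfolding D1 S_def s_def using R
    by (intro eq_matI) (auto simp: ordered_diagonal_def diagonal_mat_def)
  have SC: "S \<in> carrier_mat m n" by (simp add: S_def)
  have BC: "B \<in> carrier_mat m n" unfolding B_def by (rule change_bases_carrier[OF U1D(1) V1D(1) A01(2)])
  have s_nonneg: "0 \<le> s i" for i
    using R by (auto simp: s_def ordered_diagonal_def less_eq_dual_def less_dual_def)
  have s_zero: "min m n \<le> i \<Longrightarrow> s i = 0" for i by (auto simp: s_def)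
  obtain K L C where K: "K \<in> carrier_mat m m" "adj K = - K" and L: "L \<in> carrier_mat n n" "adj L = - L"
    and C: "C = B + (K * S + S * L)" and herm: "adj S * C = adj C * S" "S * adj C = C * adj S"
    using infinitesimal_rotation_to_hermitian[OF BC s_nonneg s_zero S_def] by metis
  have CC: "C \<in> carrier_mat m n" using BC K L SC by (simp add: C)
  obtain U2 T V2 where T: "ordered_diagonal m n T" and J2: "joint_svd S C U2 T V2"
    using joint_svd_exists[OF SC CC herm] by blast
  have U2: "unitary m U2" and V2: "unitary n V2"
    and D2: "change_bases U2 V2 S = map_mat (\<lambda>d. of_real (st d)) T"
      "change_bases U2 V2 C = map_mat (\<lambda>d. of_real (infp d)) T"
    using J2 SC by (auto simp: joint_svd_def)
  note U2D = unitaryD[OF U2] and V2D = unitaryD[OF V2]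
  have real_change: "change_bases (dual_mat U (0\<^sub>m m m)) (dual_mat V (0\<^sub>m n n)) (dual_mat X Y)
      = dual_mat (change_bases U V X) (change_bases U V Y)"
    if "unitary m U" "unitary n V" "X \<in> carrier_mat m n" "Y \<in> carrier_mat m n" for U V X Y :: "quat mat"
  proof -
    note UD = unitaryD[OF that(1)] and VD = unitaryD[OF that(2)]
    have z: "0\<^sub>m m m \<in> carrier_mat m m" "0\<^sub>m n n \<in> carrier_mat n n" by simp_all
    have UX: "adj U * X \<in> carrier_mat m n" and UY: "adj U * Y \<in> carrier_mat m n"
      using UD that by simp_all
    have UYV: "adj U * Y * V \<in> carrier_mat m n" by (rule mult_carrier_mat[OF UY VD(1)])
    have "adj (dual_mat U (0\<^sub>m m m)) * dual_mat X Y = dual_mat (adj U * X) (adj U * Y)"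
      using UY by (simp add: adj_dual_mat[OF UD(1) z(1)] dual_mat_mult[OF UD(2) z(1) that(3,4)]
          left_mult_zero_mat[OF that(3)] right_add_zero_mat[OF UY])
    moreover have "dual_mat (adj U * X) (adj U * Y) * dual_mat V (0\<^sub>m n n)
        = dual_mat (adj U * X * V) (adj U * Y * V)"
      by (simp only: dual_mat_mult[OF UX UY VD(1) z(2)] right_mult_zero_mat[OF UX] left_add_zero_mat[OF UYV])
    ultimately show ?thesis by (simp only: change_bases_def)
  qed
  define P1 where "P1 = dual_mat U1 (0\<^sub>m m m)"
  define Q1 where "Q1 = dual_mat V1 (0\<^sub>m n n)"
  define P2 where "P2 = dual_mat (1\<^sub>m m) (- K)"
  define Q2 where "Q2 = dual_mat (1\<^sub>m n) L"
  define P3 where "P3 = dual_mat U2 (0\<^sub>m m m)"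
  define Q3 where "Q3 = dual_mat V2 (0\<^sub>m n n)"
  have P: "unitary m P1" "unitary m P2" "unitary m P3"
  proof -
    have "adj (- K) = - (- K)" by (simp only: adj_uminus K(2))
    then show "unitary m P2" unfolding P2_def using K by (intro unitary_infinitesimal_rotation) auto
  qed (simp_all only: P1_def P3_def unitary_dual_mat U1 U2)
  have Q: "unitary n Q1" "unitary n Q2" "unitary n Q3"
    using unitary_infinitesimal_rotation[OF L] by (simp_all add: Q1_def Q2_def Q3_def unitary_dual_mat V1 V2)
  have step1: "change_bases P1 Q1 A = dual_mat S B"
    unfolding A_eq P1_def Q1_def by (simp only: real_change[OF U1 V1 A01] S_eq B_def)
  have step2: "change_bases P2 Q2 (dual_mat S B) = dual_mat S C"
  proof -
    have one: "1\<^sub>m m \<in> carrier_mat m m" "1\<^sub>m n \<in> carrier_mat n n" by simp_all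
    have K': "- K \<in> carrier_mat m m" using K by simp
    have "adj (- K) = K" unfolding adj_uminus K(2) by (intro eq_matI) auto
    then have "adj P2 = dual_mat (1\<^sub>m m) K" by (simp only: P2_def adj_dual_mat[OF one(1) K'] adj_one)
    then have "adj P2 * dual_mat S B = dual_mat S (B + K * S)"
      by (simp only: dual_mat_mult[OF one(1) K(1) SC BC] left_mult_one_mat[OF SC] left_mult_one_mat[OF BC])
    moreover have KS: "B + K * S \<in> carrier_mat m n" using K SC by simp
    moreover have "S * L + (B + K * S) = C"
      unfolding C using BC K L SC by (intro eq_matI) (auto simp: algebra_simps)
    ultimately show ?thesis
      by (simp only: change_bases_def Q2_def dual_mat_mult[OF SC KS one(2) L(1)]
          right_mult_one_mat[OF SC] right_mult_one_mat[OF KS])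
  qed
  have step3: "change_bases P3 Q3 (dual_mat S C) = map_mat dq_of_dual T"
    unfolding P3_def Q3_def real_change[OF U2 V2 SC CC] D2
    by (rule eq_matI) (auto simp: dq_of_dual_def)
  define U where "U = P1 * P2 * P3"
  define V where "V = Q1 * Q2 * Q3"
  have UV: "unitary m U" "unitary n V"
    unfolding U_def V_def using P Q by (auto intro: unitary_mult)
  note PD = P[THEN unitaryD(1)] and QD = Q[THEN unitaryD(1)]
  have "change_bases U V A = map_mat dq_of_dual T"
    unfolding U_def V_def
    by (simp only: change_bases_comp[OF mult_carrier_mat[OF PD(1,2)] PD(3) mult_carrier_mat[OF QD(1,2)] QD(3) A, symmetric]
        change_bases_comp[OF PD(1,2) QD(1,2) A, symmetric] step1 step2 step3)
  then have "A = U * map_mat dq_of_dual T * adj V"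
    using change_bases_inverse[OF UV A] by simp
  then have "dq_svd A U T V"
    unfolding dq_svd_iff[OF A] using UV T by blast
  then show ?thesis by blast
qed

section \<open>The norm of a dual quaternion vector and its unitary invariance\<close>

lemma dual_less_eq_iff:
  "x \<le> y \<longleftrightarrow> st x < st y \<or> st x = st y \<and> infp x \<le> infp (y :: 'a::linorder dual)"
  by (auto simp: less_eq_dual_def less_dual_def dual_eq_iff)

abbreviation st_vec :: "'a dual vec \<Rightarrow> 'a vec" where "st_vec \<equiv> map_vec st"
abbreviation infp_vec :: "'a dual vec \<Rightarrow> 'a vec" where "infp_vec \<equiv> map_vec infp"

lemma dq_abs_square: "(dq_abs q)\<^sup>2 = Dual (inner (st q) (st q)) (2 * inner (st q) (infp q))"
proof -
  have "qre (st q * conjugate (infp q) + infp q * conjugate (st q)) = 2 * inner (st q) (infp q)"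
    by (simp add: quat_times_sel conjugate_quat_def inner_quat_def algebra_simps)
  then show ?thesis
    by (auto simp: dq_abs_def dual_eq_iff power2_eq_square simp flip: power2_norm_eq_inner)
qed

text \<open>The square of a dual magnitude is \<open>|q\<^sub>0|\<^sup>2 + 2 \<langle>q\<^sub>0, q\<^sub>1\<rangle> \<epsilon>\<close> whether or not \<open>q\<close> is appreciable, so
the norm depends only on the inner products of the two parts of the vector.\<close>
lemma dq_vec_norm_eq:
  assumes x: "x \<in> carrier_vec n"
  shows "dq_vec_norm x =
    (if st_vec x \<noteq> 0\<^sub>v n
     then Dual (sqrt (vinner (st_vec x) (st_vec x)))
            (vinner (st_vec x) (infp_vec x) / sqrt (vinner (st_vec x) (st_vec x)))
     else Dual 0 (sqrt (vinner (infp_vec x) (infp_vec x))))"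
proof -
  have "(\<Sum>i<n. (dq_abs (x $ i))\<^sup>2)
      = Dual (vinner (st_vec x) (st_vec x)) (2 * vinner (st_vec x) (infp_vec x))"
    using x by (auto simp: dq_abs_square dual_eq_iff st_sum infp_sum vinner_def sum_distrib_left)
  then show ?thesis
    using x by (auto simp: dq_vec_norm_def dual_sqrt_def vinner_def power2_norm_eq_inner)
qed

lemma dq_vec_norm_eq_1_iff:
  assumes x: "x \<in> carrier_vec n"
  shows "dq_vec_norm x = 1 \<longleftrightarrow> vinner (st_vec x) (st_vec x) = 1 \<and> vinner (st_vec x) (infp_vec x) = 0"
  unfolding dq_vec_norm_eq[OF x] by (auto simp: dual_eq_iff)

lemma st_vec_mult:
  fixes A :: "'a::ring_1 dual mat"
  assumes "A \<in> carrier_mat m n" "x \<in> carrier_vec n"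
  shows "st_vec (A *\<^sub>v x) = map_mat st A *\<^sub>v st_vec x"
  using assms by (intro eq_vecI) (auto simp: scalar_prod_def st_sum)

lemma infp_vec_mult:
  fixes A :: "'a::ring_1 dual mat"
  assumes "A \<in> carrier_mat m n" "x \<in> carrier_vec n"
  shows "infp_vec (A *\<^sub>v x) = map_mat st A *\<^sub>v infp_vec x + map_mat infp A *\<^sub>v st_vec x"
  using assms by (intro eq_vecI) (auto simp: scalar_prod_def infp_sum sum.distrib)

lemma unitary_dual_parts:
  fixes U :: "'a::star_ring dual mat"
  assumes U: "unitary n U"
  defines "U0 \<equiv> map_mat st U" and "U1 \<equiv> map_mat infp U"
  shows "unitary n U0" "adj U0 * U1 + adj U1 * U0 = 0\<^sub>m n n"
proof -
  note UD = unitaryD[OF U]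
  have C: "U0 \<in> carrier_mat n n" "U1 \<in> carrier_mat n n" using UD by (simp_all add: U0_def U1_def)
  then have C': "adj U0 \<in> carrier_mat n n" "adj U1 \<in> carrier_mat n n" by simp_all
  have split: "U = dual_mat U0 U1" by (simp add: U0_def U1_def dual_mat_split)
  have inj: "map_mat st (dual_mat X Y) = X" "map_mat infp (dual_mat X Y) = Y"
    if "X \<in> carrier_mat n n" "Y \<in> carrier_mat n n" for X Y :: "'a mat"
    using that by (auto intro!: eq_matI)
  have one: "map_mat st (1\<^sub>m n :: 'a dual mat) = 1\<^sub>m n" "map_mat infp (1\<^sub>m n :: 'a dual mat) = 0\<^sub>m n n"
    by (auto intro!: eq_matI)
  have "dual_mat (adj U0 * U0) (adj U0 * U1 + adj U1 * U0) = 1\<^sub>m n"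
    using UD(3) C C' by (simp only: split adj_dual_mat[OF C] dual_mat_mult[OF C' C])
  then have 1: "adj U0 * U0 = 1\<^sub>m n" "adj U0 * U1 + adj U1 * U0 = 0\<^sub>m n n"
    using inj[of "adj U0 * U0" "adj U0 * U1 + adj U1 * U0"] C C' one by auto
  have "dual_mat (U0 * adj U0) (U0 * adj U1 + U1 * adj U0) = 1\<^sub>m n"
    using UD(4) C C' by (simp only: split adj_dual_mat[OF C] dual_mat_mult[OF C C'])
  then have "U0 * adj U0 = 1\<^sub>m n"
    using inj[of "U0 * adj U0" "U0 * adj U1 + U1 * adj U0"] C C' one by auto
  with 1 C show "unitary n U0" "adj U0 * U1 + adj U1 * U0 = 0\<^sub>m n n" by (simp_all add: unitary_def)
qed

text \<open>The standard part of \<open>U\<close> is an isometry, and the infinitesimal part contributes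
\<open>\<langle>U\<^sub>0 y, U\<^sub>1 y\<rangle>\<close> to the norm of \<open>U x\<close> (\<open>y\<close> the standard part of \<open>x\<close>), which is half of
\<open>\<langle>y, (U\<^sub>0\<^sup>* U\<^sub>1 + U\<^sub>1\<^sup>* U\<^sub>0) y\<rangle> = 0\<close>.\<close>
lemma dq_vec_norm_unitary:
  assumes U: "unitary n U" and x: "x \<in> carrier_vec n"
  shows "dq_vec_norm (U *\<^sub>v x) = dq_vec_norm x"
proof -
  define U0 where "U0 = map_mat st U"
  define U1 where "U1 = map_mat infp U"
  have U0: "unitary n U0" and skew: "adj U0 * U1 + adj U1 * U0 = 0\<^sub>m n n"
    using unitary_dual_parts[OF U] by (simp_all add: U0_def U1_def)
  note UD = unitaryD[OF U]
  have C: "U0 \<in> carrier_mat n n" "U1 \<in> carrier_mat n n" using UD by (simp_all add: U0_def U1_def)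
  define y where "y = st_vec x"
  define z where "z = infp_vec x"
  have yz: "y \<in> carrier_vec n" "z \<in> carrier_vec n" using x by (simp_all add: y_def z_def)
  have c: "U0 *\<^sub>v y \<in> carrier_vec n" "U0 *\<^sub>v z \<in> carrier_vec n" "U1 *\<^sub>v y \<in> carrier_vec n"
    using C yz by simp_all
  have st: "st_vec (U *\<^sub>v x) = U0 *\<^sub>v y" and inf: "infp_vec (U *\<^sub>v x) = U0 *\<^sub>v z + U1 *\<^sub>v y"
    using st_vec_mult[OF UD(1) x] infp_vec_mult[OF UD(1) x] by (simp_all add: U0_def U1_def y_def z_def)
  have Ux: "U *\<^sub>v x \<in> carrier_vec n" using UD x by simp
  have yy: "vinner (U0 *\<^sub>v y) (U0 *\<^sub>v y) = vinner y y"
    and yz': "vinner (U0 *\<^sub>v y) (U0 *\<^sub>v z) = vinner y z"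
    and zz: "vinner (U0 *\<^sub>v z) (U0 *\<^sub>v z) = vinner z z"
    using unitary_vinner[OF U0] yz by simp_all
  have "vinner y ((adj U0 * U1 + adj U1 * U0) *\<^sub>v y)
      = vinner (U0 *\<^sub>v y) (U1 *\<^sub>v y) + vinner (U1 *\<^sub>v y) (U0 *\<^sub>v y)"
  proof -
    have p: "adj U0 * U1 \<in> carrier_mat n n" "adj U1 * U0 \<in> carrier_mat n n"
      using C by (auto intro!: mult_carrier_mat)
    have q: "(adj U0 * U1) *\<^sub>v y \<in> carrier_vec n" "(adj U1 * U0) *\<^sub>v y \<in> carrier_vec n"
      using p yz by (auto intro!: mult_mat_vec_carrier)
    show ?thesis
      by (simp only: add_mult_distrib_mat_vec[OF p yz(1)] vinner_add_right[OF q yz(1)]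
          vinner_gram[OF C yz(1)] vinner_gram[OF C(2,1) yz(1)])
  qed
  moreover have "vinner y ((adj U0 * U1 + adj U1 * U0) *\<^sub>v y) = 0"
    using yz by (simp add: skew vinner_def)
  moreover have "vinner (U1 *\<^sub>v y) (U0 *\<^sub>v y) = vinner (U0 *\<^sub>v y) (U1 *\<^sub>v y)"
    using C by (intro vinner_commute) simp
  ultimately have "vinner (U0 *\<^sub>v y) (U1 *\<^sub>v y) = 0" by simp
  then have cross: "vinner (U0 *\<^sub>v y) (U0 *\<^sub>v z + U1 *\<^sub>v y) = vinner y z"
    by (simp only: vinner_add_right[OF c(2,3,1)] yz' add_0_right)
  have zero: "U0 *\<^sub>v y = 0\<^sub>v n \<longleftrightarrow> y = 0\<^sub>v n"
    using yy vinner_eq_0_iff[OF c(1)] vinner_eq_0_iff[OF yz(1)] by simp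
  have "U1 *\<^sub>v y = 0\<^sub>v n" if "y = 0\<^sub>v n" using C that by (auto simp: vec_eq_iff scalar_prod_def)
  then have "vinner (U0 *\<^sub>v z + U1 *\<^sub>v y) (U0 *\<^sub>v z + U1 *\<^sub>v y) = vinner z z" if "y = 0\<^sub>v n"
    using that zz right_zero_vec[OF c(2)] by simp
  with zero show ?thesis
    by (simp add: dq_vec_norm_eq[OF Ux] dq_vec_norm_eq[OF x] st inf yy cross flip: y_def z_def)
qed

section \<open>The largest singular value as a maximum\<close>

lemma vinner_diagonal:
  fixes f g :: "dual_real \<Rightarrow> real"
  assumes S: "S \<in> carrier_mat m n" "diagonal_mat S" and fg: "f 0 = 0" "g 0 = 0"
    and z: "z \<in> carrier_vec n" and w: "w \<in> carrier_vec n"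
  shows "vinner (map_mat (\<lambda>d. of_real (f d)) S *\<^sub>v z) (map_mat (\<lambda>d. of_real (g d)) S *\<^sub>v w :: quat vec)
    = (\<Sum>i<n. if i < m then f (S $$ (i, i)) * g (S $$ (i, i)) * inner (z $ i) (w $ i) else 0)"
proof -
  have entry: "(map_mat (\<lambda>d. of_real (h d)) S *\<^sub>v v) $ i = (if i < n then h (S $$ (i, i)) *\<^sub>R v $ i else 0)"
    if "i < m" "h 0 = 0" "v \<in> carrier_vec n" for h :: "dual_real \<Rightarrow> real" and v :: "quat vec" and i
  proof -
    have "(map_mat (\<lambda>d. of_real (h d)) S *\<^sub>v v) $ i
        = (\<Sum>j<n. of_real (h (S $$ (i, j))) * v $ j)"
      using that S by (simp add: scalar_prod_def lessThan_atLeast0)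
    also have "\<dots> = (\<Sum>j<n. if j = i then h (S $$ (i, i)) *\<^sub>R v $ i else 0)"
      using that S by (intro sum.cong) (auto simp: diagonal_mat_def of_real_mult_quat)
    finally show ?thesis by simp
  qed
  have "vinner (map_mat (\<lambda>d. of_real (f d)) S *\<^sub>v z) (map_mat (\<lambda>d. of_real (g d)) S *\<^sub>v w :: quat vec)
      = (\<Sum>i<m. if i < n then f (S $$ (i, i)) * g (S $$ (i, i)) * inner (z $ i) (w $ i) else 0)"
    using S fg z w by (auto simp: vinner_def entry simp del: index_mult_mat_vec intro!: sum.cong)
  also have "\<dots> = (\<Sum>i\<in>{..<m} \<inter> {..<n}. f (S $$ (i, i)) * g (S $$ (i, i)) * inner (z $ i) (w $ i))"
    by (simp add: sum.inter_restrict)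
  also have "\<dots> = (\<Sum>i<n. if i < m then f (S $$ (i, i)) * g (S $$ (i, i)) * inner (z $ i) (w $ i) else 0)"
    by (subst Int_commute) (simp add: sum.inter_restrict)
  finally show ?thesis .
qed

lemma diagonal_norm_formula:
  assumes S: "ordered_diagonal m n S" and x: "x \<in> carrier_vec n"
  defines "s i \<equiv> if i < m then st (S $$ (i, i)) else 0" and "b i \<equiv> if i < m then infp (S $$ (i, i)) else 0"
  defines "y \<equiv> st_vec x" and "z \<equiv> infp_vec x"
  defines "p i \<equiv> inner (y $ i) (y $ i)"
  shows "dq_vec_norm (map_mat dq_of_dual S *\<^sub>v x) =
    (let N = \<Sum>i<n. (s i)\<^sup>2 * p i in
     if N \<noteq> 0 then Dual (sqrt N) ((\<Sum>i<n. (s i)\<^sup>2 * inner (y $ i) (z $ i) + s i * b i * p i) / sqrt N)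
     else Dual 0 (sqrt (\<Sum>i<n. (norm (s i *\<^sub>R z $ i + b i *\<^sub>R y $ i))\<^sup>2)))"
proof -
  have SC: "S \<in> carrier_mat m n" "diagonal_mat S" using S by (simp_all add: ordered_diagonal_def)
  define D0 where "D0 = map_mat (\<lambda>d. of_real (st d) :: quat) S"
  define D1 where "D1 = map_mat (\<lambda>d. of_real (infp d) :: quat) S"
  have D: "map_mat dq_of_dual S \<in> carrier_mat m n" "D0 \<in> carrier_mat m n" "D1 \<in> carrier_mat m n"
    using SC by (simp_all add: D0_def D1_def)
  have parts: "map_mat st (map_mat dq_of_dual S) = D0" "map_mat infp (map_mat dq_of_dual S) = D1"
    by (auto simp: D0_def D1_def dq_of_dual_def)
  have yz: "y \<in> carrier_vec n" "z \<in> carrier_vec n" using x by (simp_all add: y_def z_def)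
  have Dx: "map_mat dq_of_dual S *\<^sub>v x \<in> carrier_vec m" using D x by simp
  have c: "D0 *\<^sub>v y \<in> carrier_vec m" "D0 *\<^sub>v z \<in> carrier_vec m" "D1 *\<^sub>v y \<in> carrier_vec m"
    using D yz by simp_all
  have st: "st_vec (map_mat dq_of_dual S *\<^sub>v x) = D0 *\<^sub>v y"
    using st_vec_mult[OF D(1) x] by (simp only: parts y_def)
  have inf: "infp_vec (map_mat dq_of_dual S *\<^sub>v x) = D0 *\<^sub>v z + D1 *\<^sub>v y"
    using infp_vec_mult[OF D(1) x] by (simp only: parts y_def z_def)
  have ip: "vinner (D0 *\<^sub>v v) (D0 *\<^sub>v w) = (\<Sum>i<n. (s i)\<^sup>2 * inner (v $ i) (w $ i))"
    "vinner (D0 *\<^sub>v v) (D1 *\<^sub>v w) = (\<Sum>i<n. s i * b i * inner (v $ i) (w $ i))"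
    "vinner (D1 *\<^sub>v v) (D1 *\<^sub>v w) = (\<Sum>i<n. (b i)\<^sup>2 * inner (v $ i) (w $ i))"
    if "v \<in> carrier_vec n" "w \<in> carrier_vec n" for v w
    unfolding D0_def D1_def
    by (subst vinner_diagonal[OF SC _ _ that]; auto simp: s_def b_def power2_eq_square intro!: sum.cong)+
  have N: "vinner (D0 *\<^sub>v y) (D0 *\<^sub>v y) = (\<Sum>i<n. (s i)\<^sup>2 * p i)"
    by (simp add: ip yz p_def)
  have cross: "vinner (D0 *\<^sub>v y) (D0 *\<^sub>v z + D1 *\<^sub>v y)
      = (\<Sum>i<n. (s i)\<^sup>2 * inner (y $ i) (z $ i) + s i * b i * p i)"
    by (simp only: vinner_add_right[OF c(2,3,1)] ip[OF yz] ip[OF yz(1,1)] sum.distrib p_def)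
  have "vinner (D1 *\<^sub>v y) (D0 *\<^sub>v z) = vinner (D0 *\<^sub>v z) (D1 *\<^sub>v y)"
    using D by (intro vinner_commute) simp
  then have "vinner (D0 *\<^sub>v z + D1 *\<^sub>v y) (D0 *\<^sub>v z + D1 *\<^sub>v y)
      = vinner (D0 *\<^sub>v z) (D0 *\<^sub>v z) + 2 * vinner (D0 *\<^sub>v z) (D1 *\<^sub>v y) + vinner (D1 *\<^sub>v y) (D1 *\<^sub>v y)"
    using c by (simp add: vinner_add_left[OF c(2,3)] vinner_add_right[OF c(2,3)])
  also have "\<dots> = (\<Sum>i<n. (norm (s i *\<^sub>R z $ i + b i *\<^sub>R y $ i))\<^sup>2)"
    unfolding power2_norm_eq_inner
    by (simp add: ip yz inner_add_left inner_add_right sum.distrib sum_distrib_left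
        inner_commute power2_eq_square algebra_simps)
  finally have sq: "vinner (D0 *\<^sub>v z + D1 *\<^sub>v y) (D0 *\<^sub>v z + D1 *\<^sub>v y)
      = (\<Sum>i<n. (norm (s i *\<^sub>R z $ i + b i *\<^sub>R y $ i))\<^sup>2)" .
  show ?thesis
    unfolding dq_vec_norm_eq[OF Dx] st inf cross sq N Let_def vinner_eq_0_iff[OF c(1), symmetric] by simp
qed

text \<open>The standard part of the norm is the root of a weighted mean of the \<open>s\<^sub>i\<^sup>2\<close> with weights
\<open>p\<^sub>i = |y\<^sub>i|\<^sup>2\<close>, hence at most \<open>s\<^sub>0\<close>. If it equals \<open>s\<^sub>0 > 0\<close>, the weights live on the indices with
\<open>s\<^sub>i = s\<^sub>0\<close>. There the terms with \<open>z\<close> sum to \<open>s\<^sub>0\<^sup>2 \<langle>y, z\<rangle> = 0\<close>, and what remains of the infinitesimal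
part is a weighted mean of the \<open>b\<^sub>i\<close> on a block of ties, where \<open>b\<^sub>i \<le> b\<^sub>0\<close> by the dual order. If
\<open>s\<^sub>0 = 0\<close>, everything is infinitesimal and the same mean argument applies to the \<open>b\<^sub>i\<^sup>2\<close>.\<close>
lemma diagonal_norm_le:
  assumes S: "ordered_diagonal m n S" and mn: "0 < m" "0 < n"
    and x: "x \<in> carrier_vec n" and unit: "dq_vec_norm x = 1"
  shows "dq_vec_norm (map_mat dq_of_dual S *\<^sub>v x) \<le> S $$ (0, 0)"
proof -
  define s where "s i = (if i < m then st (S $$ (i, i)) else 0)" for i
  define b where "b i = (if i < m then infp (S $$ (i, i)) else 0)" for i
  define y where "y = st_vec x"
  define z where "z = infp_vec x"
  define p where "p i = inner (y $ i) (y $ i)" for i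
  define N where "N = (\<Sum>i<n. (s i)\<^sup>2 * p i)"
  define X where "X = (\<Sum>i<n. (s i)\<^sup>2 * inner (y $ i) (z $ i) + s i * b i * p i)"
  define R where "R = (\<Sum>i<n. (norm (s i *\<^sub>R z $ i + b i *\<^sub>R y $ i))\<^sup>2)"
  have norm_eq: "dq_vec_norm (map_mat dq_of_dual S *\<^sub>v x)
      = (if N \<noteq> 0 then Dual (sqrt N) (X / sqrt N) else Dual 0 (sqrt R))"
    unfolding diagonal_norm_formula[OF S x]
    by (simp add: Let_def N_def X_def R_def s_def b_def y_def z_def p_def)
  have S_range: "0 \<le> S $$ (i, i)" "S $$ (i, i) \<le> S $$ (0, 0)" if "i < m" "i < n" for i
    using S that by (auto simp: ordered_diagonal_def)
  have S0: "st (S $$ (0, 0)) = s 0" "infp (S $$ (0, 0)) = b 0" using mn by (simp_all add: s_def b_def)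
  have s: "0 \<le> s i" "s i \<le> s 0" if "i < n" for i
    using S_range[of i] S_range[of 0] that mn by (auto simp: s_def dual_less_eq_iff)
  have b: "b i \<le> b 0" if "i < n" "i < m" "s i = s 0" for i
    using S_range[of i] that mn by (auto simp: s_def b_def dual_less_eq_iff)
  have p: "0 \<le> p i" for i by (simp add: p_def)
  have p_sum: "(\<Sum>i<n. p i) = 1" and yz: "(\<Sum>i<n. inner (y $ i) (z $ i)) = 0"
    using unit x by (simp_all add: dq_vec_norm_eq_1_iff[OF x] vinner_def p_def y_def z_def)
  have s_sq: "(s i)\<^sup>2 \<le> (s 0)\<^sup>2" if "i < n" for i using s[OF that] by (rule power_mono[rotated])
  \<comment> \<open>The distance of the weighted mean from \<open>s\<^sub>0\<^sup>2\<close> as a sum of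
    nonnegative terms: all of them vanish in the case of equality.\<close>
  have gap: "(\<Sum>i<n. ((s 0)\<^sup>2 - (s i)\<^sup>2) * p i) = (s 0)\<^sup>2 - N"
    using p_sum by (simp add: N_def left_diff_distrib sum_subtractf flip: sum_distrib_left)
  have gap_nonneg: "0 \<le> ((s 0)\<^sup>2 - (s i)\<^sup>2) * p i" if "i < n" for i
    using s_sq[OF that] p[of i] by simp
  have N_le: "N \<le> (s 0)\<^sup>2"
    using gap gap_nonneg sum_nonneg[of "{..<n}" "\<lambda>i. ((s 0)\<^sup>2 - (s i)\<^sup>2) * p i"] by simp
  have N_nonneg: "0 \<le> N" unfolding N_def by (intro sum_nonneg) (simp add: p)
  have s0: "0 \<le> s 0" using s[of 0] mn by simp
  show ?thesis
  proof (cases "N = 0")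
    case N: False
    have "sqrt N \<le> s 0" using N_le s0 by (metis real_sqrt_le_mono real_sqrt_abs abs_of_nonneg)
    moreover have "X / sqrt N \<le> b 0" if eq: "sqrt N = s 0"
    proof -
      have s0pos: "s 0 > 0" using N N_nonneg eq by (metis less_eq_real_def real_sqrt_gt_zero)
      have "N = (s 0)\<^sup>2" using eq N_nonneg by (metis real_sqrt_pow2)
      then have gap_zero: "((s 0)\<^sup>2 - (s i)\<^sup>2) * p i = 0" if "i < n" for i
        using gap gap_nonneg that
          sum_nonneg_eq_0_iff[of "{..<n}" "\<lambda>i. ((s 0)\<^sup>2 - (s i)\<^sup>2) * p i"] by simp
      have conc: "s i = s 0 \<and> i < m \<or> y $ i = 0" if i: "i < n" for i
      proof (cases "y $ i = 0")
        case False
        then have "(s i)\<^sup>2 = (s 0)\<^sup>2" using gap_zero[OF i] by (simp add: p_def)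
        then have "s i = s 0" using s[OF i] s0 by (simp add: power2_eq_iff_nonneg)
        moreover from this have "i < m" using s0pos s_def[of i] by (cases "i < m") auto
        ultimately show ?thesis by simp
      qed simp
      have "X \<le> (\<Sum>i<n. (s 0)\<^sup>2 * inner (y $ i) (z $ i) + s 0 * b 0 * p i)"
        unfolding X_def
      proof (rule sum_mono)
        fix i assume "i \<in> {..<n}"
        then have i: "i < n" by simp
        show "(s i)\<^sup>2 * inner (y $ i) (z $ i) + s i * b i * p i
            \<le> (s 0)\<^sup>2 * inner (y $ i) (z $ i) + s 0 * b 0 * p i"
          using conc[OF i]
        proof
          assume "s i = s 0 \<and> i < m"
          then show ?thesis using b[OF i] s0 p[of i] by (auto intro!: mult_right_mono mult_left_mono)
        qed (simp add: p_def)
      qed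
      also have "\<dots> = s 0 * b 0"
        by (simp add: sum.distrib yz p_sum flip: sum_distrib_left)
      finally show ?thesis using s0pos by (simp add: eq field_simps)
    qed
    ultimately show ?thesis using N by (auto simp: norm_eq dual_less_eq_iff S0)
  next
    case N: True
    show ?thesis
    proof (cases "s 0 = 0")
      case True
      have s_zero: "s i = 0" if "i < n" for i using s[OF that] True by simp
      have b_nonneg: "0 \<le> b i" "b i \<le> b 0" if "i < n" for i
        using s_zero[OF that] True S_range[of i] S_range[of 0] that mn
        by (auto simp: s_def b_def dual_less_eq_iff)
      have "R = (\<Sum>i<n. (b i)\<^sup>2 * p i)"
        unfolding R_def by (intro sum.cong) (simp_all add: s_zero p_def power_mult_distrib flip: power2_norm_eq_inner)
      also have "\<dots> \<le> (\<Sum>i<n. (b 0)\<^sup>2 * p i)"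
        using b_nonneg p by (intro sum_mono mult_right_mono power_mono) auto
      also have "\<dots> = (b 0)\<^sup>2" by (simp add: p_sum flip: sum_distrib_left)
      finally have "sqrt R \<le> b 0"
        using b_nonneg[of 0] mn by (metis real_sqrt_le_mono real_sqrt_abs abs_of_nonneg)
      then show ?thesis using N True by (simp add: norm_eq dual_less_eq_iff S0)
    next
      case False
      then show ?thesis using N s0 by (simp add: norm_eq dual_less_eq_iff S0)
    qed
  qed
qed

lemma diagonal_norm_unit_vec:
  assumes S: "ordered_diagonal m n S" and mn: "0 < m" "0 < n"
  shows "dq_vec_norm (unit_vec n 0) = 1"
    and "dq_vec_norm (map_mat dq_of_dual S *\<^sub>v unit_vec n 0) = S $$ (0, 0)"
proof -
  have e: "st_vec (unit_vec n 0) = (unit_vec n 0 :: quat vec)"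
    "infp_vec (unit_vec n 0) = (0\<^sub>v n :: quat vec)"
    by (auto simp: unit_vec_def)
  have c: "(unit_vec n 0 :: dual_quat vec) \<in> carrier_vec n" by simp
  show "dq_vec_norm (unit_vec n 0) = 1"
    using mn by (simp add: dq_vec_norm_eq_1_iff[OF c] e) (simp add: vinner_def)
  have pos: "0 \<le> S $$ (0, 0)" using S mn by (simp add: ordered_diagonal_def)
  have e_index: "unit_vec n 0 $ i = (if i = 0 then 1 else 0 :: quat)" if "i < n" for i
    using that mn by (simp add: unit_vec_def)
  have sum0: "(\<Sum>i<n. if i = 0 then c else 0) = (c::real)" for c using mn by simp
  let ?s = "\<lambda>i. if i < m then st (S $$ (i, i)) else 0"
  let ?b = "\<lambda>i. if i < m then infp (S $$ (i, i)) else 0"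
  have one: "inner (1::quat) 1 = 1" by (simp add: inner_quat_def)
  have "(\<Sum>i<n. (?s i)\<^sup>2 * inner (unit_vec n 0 $ i) (unit_vec n 0 $ i :: quat))
      = (\<Sum>i<n. if i = 0 then (st (S $$ (0, 0)))\<^sup>2 else 0)"
    using mn by (intro sum.cong) (auto simp: e_index one)
  moreover have "(\<Sum>i<n. (?s i)\<^sup>2 * inner (unit_vec n 0 $ i) (0\<^sub>v n $ i)
        + ?s i * ?b i * inner (unit_vec n 0 $ i) (unit_vec n 0 $ i :: quat))
      = (\<Sum>i<n. if i = 0 then st (S $$ (0, 0)) * infp (S $$ (0, 0)) else 0)"
    using mn by (intro sum.cong) (auto simp: e_index one)
  moreover have "(\<Sum>i<n. (norm (?s i *\<^sub>R 0\<^sub>v n $ i + ?b i *\<^sub>R (unit_vec n 0 $ i :: quat)))\<^sup>2)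
      = (\<Sum>i<n. if i = 0 then (infp (S $$ (0, 0)))\<^sup>2 else 0)"
    using mn by (intro sum.cong) (auto simp: e_index)
  ultimately show "dq_vec_norm (map_mat dq_of_dual S *\<^sub>v unit_vec n 0) = S $$ (0, 0)"
    unfolding diagonal_norm_formula[OF S c] e sum0
    using pos by (auto simp: Let_def dual_eq_iff dual_less_eq_iff)
qed

text \<open>Stated for an arbitrary decomposition, so that it also shows the leading diagonal entry to be the same
in all of them.\<close>
lemma dq_svd_norm_max:
  assumes A: "A \<in> carrier_mat m n" and mn: "0 < m" "0 < n" and svd: "dq_svd A U S V"
  shows "\<exists>x\<in>carrier_vec n. dq_vec_norm x = 1 \<and> dq_vec_norm (A *\<^sub>v x) = S $$ (0, 0)"
    and "\<forall>x\<in>carrier_vec n. dq_vec_norm x = 1 \<longrightarrow> dq_vec_norm (A *\<^sub>v x) \<le> S $$ (0, 0)"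
proof -
  have U: "unitary m U" and V: "unitary n V" and S: "ordered_diagonal m n S"
    and A_eq: "A = U * map_mat dq_of_dual S * adj V"
    using svd unfolding dq_svd_iff[OF A] by blast+
  note UD = unitaryD[OF U] and VD = unitaryD[OF V]
  define D where "D = map_mat dq_of_dual S"
  have D: "D \<in> carrier_mat m n" using S by (simp add: D_def ordered_diagonal_def)
  have norm_A: "dq_vec_norm (A *\<^sub>v x) = dq_vec_norm (D *\<^sub>v (adj V *\<^sub>v x))"
    if x: "x \<in> carrier_vec n" for x
  proof -
    have Vx: "adj V *\<^sub>v x \<in> carrier_vec n" using VD x by (auto intro: mult_mat_vec_carrier)
    have Dx: "D *\<^sub>v (adj V *\<^sub>v x) \<in> carrier_vec m" using D Vx by (rule mult_mat_vec_carrier)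
    have "A *\<^sub>v x = U *\<^sub>v (D *\<^sub>v (adj V *\<^sub>v x))"
      unfolding A_eq D_def[symmetric]
      by (simp only: assoc_mult_mat_vec[OF mult_carrier_mat[OF UD(1) D] VD(2) x]
          assoc_mult_mat_vec[OF UD(1) D Vx])
    then show ?thesis by (simp only: dq_vec_norm_unitary[OF U Dx])
  qed
  show "\<forall>x\<in>carrier_vec n. dq_vec_norm x = 1 \<longrightarrow> dq_vec_norm (A *\<^sub>v x) \<le> S $$ (0, 0)"
  proof (intro ballI impI)
    fix x assume x: "x \<in> carrier_vec n" "dq_vec_norm x = 1"
    have "adj V *\<^sub>v x \<in> carrier_vec n" using VD x by (auto intro: mult_mat_vec_carrier)
    then show "dq_vec_norm (A *\<^sub>v x) \<le> S $$ (0, 0)"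
      unfolding norm_A[OF x(1)] D_def
      using dq_vec_norm_unitary[OF unitary_adj[OF V] x(1)] x(2) by (intro diagonal_norm_le[OF S mn]) simp_all
  qed
  let ?e = "unit_vec n 0 :: dual_quat vec"
  have e: "?e \<in> carrier_vec n" by simp
  have Ve: "V *\<^sub>v ?e \<in> carrier_vec n" using VD(1) e by (rule mult_mat_vec_carrier)
  have "adj V *\<^sub>v (V *\<^sub>v ?e) = ?e"
    using assoc_mult_mat_vec[OF VD(2,1) e] by (simp only: VD(3) one_mult_mat_vec[OF e])
  then have "dq_vec_norm (A *\<^sub>v (V *\<^sub>v ?e)) = S $$ (0, 0)"
    unfolding norm_A[OF Ve] D_def by (simp only: diagonal_norm_unit_vec[OF S mn])
  moreover have "dq_vec_norm (V *\<^sub>v ?e) = 1"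
    by (simp only: dq_vec_norm_unitary[OF V e] diagonal_norm_unit_vec[OF S mn])
  ultimately show "\<exists>x\<in>carrier_vec n. dq_vec_norm x = 1 \<and> dq_vec_norm (A *\<^sub>v x) = S $$ (0, 0)"
    using Ve by blast
qed

theorem proposition3p3:
  fixes A :: "dual_quat mat" and m n :: nat
  assumes "A \<in> carrier_mat m n" and "0 < m" and "0 < n"
  shows "(\<exists>x \<in> carrier_vec n. dq_vec_norm x = 1 \<and> dq_vec_norm (A *\<^sub>v x) = spectral_norm A)
    \<and> (\<forall>x \<in> carrier_vec n. dq_vec_norm x = 1 \<longrightarrow> dq_vec_norm (A *\<^sub>v x) \<le> spectral_norm A)
    \<and> spectral_norm A = singular_value A 1"
proof -
  note max = dq_svd_norm_max[OF assms]
  obtain U S V where svd: "dq_svd A U S V" using dq_svd_exists[OF assms(1)] by blast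
  have norm: "spectral_norm A = S $$ (0, 0)"
    unfolding spectral_norm_def
    using max[OF svd] assms(1) by (intro Greatest_equality) auto
  have "singular_value A 1 = S $$ (0, 0)"
    unfolding singular_value_def
  proof (rule the_equality)
    show "\<exists>U S' V. dq_svd A U S' V \<and> S $$ (0, 0) = S' $$ (1 - 1, 1 - 1)" using svd by auto
    fix s assume "\<exists>U S V. dq_svd A U S V \<and> s = S $$ (1 - 1, 1 - 1)"
    then obtain U' S' V' where svd': "dq_svd A U' S' V'" and s: "s = S' $$ (0, 0)" by auto
    show "s = S $$ (0, 0)"
      unfolding s using max[OF svd] max[OF svd'] by (metis order_antisym)
  qed
  with norm max[OF svd] show ?thesis by simp
qed

end
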